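(* The Kan fibration $\pi\colon \tilde U\to U$ is a universal $\kappa$-small Kan fibration. That is, $\pi$ is a $\kappa$-small Kan fibration and it satisfies the following realignment property. Suppose given a monomorphism of simplicial sets $i\colon A\to B$, $\kappa$-small Kan fibrations $q\colon D\to A$ and $p\colon E\to B$, a pullback square from $q$ to $p$ with top map $j\colon D\to E$ and bottom map $i\colon A\to B$, and a pullback square from $q$ to $\pi$ with top map $g\colon D\to\tilde U$ and bottom map $h\colon A\to U$. Then there exist maps $k\colon B\to U$ and $\ell\colon E\to \tilde U$ forming a pullback square from $p$ to $\pi$ such that $k\cdot i=h$ and $\ell\cdot j=g$.
   Context: Let $\Delta$ be the category of finite non-empty ordinals $[n]=\{0,\dots,n\}$ and order-preserving maps; simplicial sets are presheaves of sets on $\Delta$, and $\Delta^n$ is the presheaf represented by $[n]$. Fix a regular cardinal $\kappa$ larger than the cardinality of the set of morphisms of $\Delta$. A map $f\colon E\to B$ of simplicial sets ($B$ arbitrary) is $\kappa$-small if for all $n$ and all $b\in B_n$ the fiber of $E_n\to B_n$ over $b$ has cardinality $<\kappa$. A Kan fibration is a map with the right lifting property against all horn inclusions $\Lambda^n_k\to\Delta^n$, $n\ge 1$, $0\le k\le n$. Let $\mathsf{set}$ be a (small) full subcategory of the category of sets of cardinality $<\kappa$, containing at least one set of each cardinality $\lambda<\kappa$ and at most $\kappa$ many sets of each cardinality, and let $\mathsf{set}_*$ be the category of pointed sets whose underlying set lies in $\mathsf{set}$. The Hofmann--Streicher universe $\pi\colon\tilde V\to V$ is the following map of simplicial sets: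 $V_n$ is the set of functors $A\colon(\Delta_{/[n]})^{\mathrm{op}}\to\mathsf{set}$, $\tilde V_n$ is the set of functors $(\Delta_{/[n]})^{\mathrm{op}}\to\mathsf{set}_*$, a simplicial operator $\alpha\colon[m]\to[n]$ acts by precomposition with the composition functor $\Delta_{/[m]}\to\Delta_{/[n]}$, and $\tilde V\to V$ is induced by the forgetful functor $\mathsf{set}_*\to\mathsf{set}$. Let $U\subseteq V$ be the simplicial subset whose $n$-simplices are those $A\colon\Delta^n\to V$ for which the pullback of $\tilde V\to V$ along $A$ is a Kan fibration over $\Delta^n$, and let $\pi\colon\tilde U\to U$ be the pullback of $\tilde V\to V$ along the inclusion $U\hookrightarrow V$. *)

theory Defs
  imports "HOL-Library.FuncSet"
begin

unbundle cardinal_syntax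

section \<open>Categories and functors\<close>

record ('o, 'm) cat =
  Ob :: "'o set"
  Ar :: "'m set"
  Dom :: "'m \<Rightarrow> 'o"
  Cod :: "'m \<Rightarrow> 'o"
  Idn :: "'o \<Rightarrow> 'm"
  Cmp :: "'m \<Rightarrow> 'm \<Rightarrow> 'm"

text \<open>\<^term>\<open>Cmp C g f\<close> is the composite of \<^term>\<open>f\<close> followed by \<^term>\<open>g\<close>.\<close>

definition is_cat :: "('o, 'm) cat \<Rightarrow> bool" where
  "is_cat C \<longleftrightarrow>
     (\<forall>x\<in>Ob C. Idn C x \<in> Ar C \<and> Dom C (Idn C x) = x \<and> Cod C (Idn C x) = x) \<and>
     (\<forall>f\<in>Ar C. Dom C f \<in> Ob C \<and> Cod C f \<in> Ob C) \<and>
     (\<forall>f\<in>Ar C. \<forall>g\<in>Ar C. Cod C f = Dom C g \<longrightarrow>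
        Cmp C g f \<in> Ar C \<and> Dom C (Cmp C g f) = Dom C f \<and> Cod C (Cmp C g f) = Cod C g) \<and>
     (\<forall>f\<in>Ar C. Cmp C (Idn C (Cod C f)) f = f \<and> Cmp C f (Idn C (Dom C f)) = f) \<and>
     (\<forall>f\<in>Ar C. \<forall>g\<in>Ar C. \<forall>h\<in>Ar C. Cod C f = Dom C g \<longrightarrow> Cod C g = Dom C h \<longrightarrow>
        Cmp C h (Cmp C g f) = Cmp C (Cmp C h g) f)"

definition op_cat :: "('o, 'm) cat \<Rightarrow> ('o, 'm) cat" where
  "op_cat C = \<lparr>Ob = Ob C, Ar = Ar C, Dom = Cod C, Cod = Dom C, Idn = Idn C,
     Cmp = (\<lambda>g f. Cmp C f g)\<rparr>"

text \<open>Objects of the slice are the arrows into \<^term>\<open>c\<close>; an arrow from \<^term>\<open>f\<close> to \<^term>\<open>g\<close> is a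
  commutative triangle \<^term>\<open>(f, g, u)\<close> with \<^term>\<open>f = Cmp C g u\<close>.\<close>

definition slice_cat :: "('o, 'm) cat \<Rightarrow> 'o \<Rightarrow> ('m, 'm \<times> 'm \<times> 'm) cat" where
  "slice_cat C c = \<lparr>
     Ob = {f \<in> Ar C. Cod C f = c},
     Ar = {(f, g, u). f \<in> Ar C \<and> Cod C f = c \<and> g \<in> Ar C \<and> Cod C g = c \<and> u \<in> Ar C \<and>
             Dom C u = Dom C f \<and> Cod C u = Dom C g \<and> Cmp C g u = f},
     Dom = (\<lambda>(f, g, u). f),
     Cod = (\<lambda>(f, g, u). g),
     Idn = (\<lambda>f. (f, f, Idn C (Dom C f))),
     Cmp = (\<lambda>(_, h, v) (f, _, u). (f, h, Cmp C v u))\<rparr>"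

text \<open>Categories of structured sets: the object \<^term>\<open>X\<close> has underlying set \<^term>\<open>U X\<close>, and an arrow
  is a map of underlying sets satisfying \<^term>\<open>P\<close>, tagged with its domain and codomain.
  Maps are extensional, so that equality of arrows is equality of maps on the domain.\<close>

definition concrete_cat ::
  "'o set \<Rightarrow> ('o \<Rightarrow> 'u set) \<Rightarrow> ('o \<Rightarrow> 'o \<Rightarrow> ('u \<Rightarrow> 'u) \<Rightarrow> bool) \<Rightarrow> ('o, 'o \<times> 'o \<times> ('u \<Rightarrow> 'u)) cat"
where
  "concrete_cat Obs U P = \<lparr>
     Ob = Obs,
     Ar = {(X, Y, f). X \<in> Obs \<and> Y \<in> Obs \<and> f \<in> U X \<rightarrow>\<^sub>E U Y \<and> P X Y f},
     Dom = (\<lambda>(X, Y, f). X),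
     Cod = (\<lambda>(X, Y, f). Y),
     Idn = (\<lambda>X. (X, X, \<lambda>x\<in>U X. x)),
     Cmp = (\<lambda>(_, Z, g) (X, _, f). (X, Z, compose (U X) g f))\<rparr>"

type_synonym 'u set_arrow = "'u set \<times> 'u set \<times> ('u \<Rightarrow> 'u)"
type_synonym 'u pset_arrow = "('u set \<times> 'u) \<times> ('u set \<times> 'u) \<times> ('u \<Rightarrow> 'u)"
type_synonym delta_arrow = "nat \<times> nat \<times> (nat \<Rightarrow> nat)"

definition set_cat :: "'u set set \<Rightarrow> ('u set, 'u set_arrow) cat" where
  "set_cat S = concrete_cat S (\<lambda>X. X) (\<lambda>X Y f. True)"

definition pset_cat :: "'u set set \<Rightarrow> ('u set \<times> 'u, 'u pset_arrow) cat" where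
  "pset_cat S = concrete_cat {(X, x). X \<in> S \<and> x \<in> X} fst (\<lambda>(X, x) (Y, y) f. f x = y)"

text \<open>The object \<^term>\<open>n\<close> of \<open>Delta\<close> is the ordinal \<^term>\<open>{..n}\<close>, with \<^term>\<open>n + 1\<close> elements.\<close>

definition Delta :: "(nat, delta_arrow) cat" where
  "Delta = concrete_cat UNIV (\<lambda>n. {..n}) (\<lambda>m n f. mono_on {..m} f)"

record ('o, 'm, 'p, 'q) func =
  on_ob :: "'o \<Rightarrow> 'p"
  on_ar :: "'m \<Rightarrow> 'q"

definition is_functor :: "('o, 'm) cat \<Rightarrow> ('p, 'q) cat \<Rightarrow> ('o, 'm, 'p, 'q) func \<Rightarrow> bool" where
  "is_functor C D F \<longleftrightarrow>
     on_ob F \<in> Ob C \<rightarrow>\<^sub>E Ob D \<and>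
     on_ar F \<in> Ar C \<rightarrow>\<^sub>E Ar D \<and>
     (\<forall>f\<in>Ar C. Dom D (on_ar F f) = on_ob F (Dom C f) \<and> Cod D (on_ar F f) = on_ob F (Cod C f)) \<and>
     (\<forall>x\<in>Ob C. on_ar F (Idn C x) = Idn D (on_ob F x)) \<and>
     (\<forall>f\<in>Ar C. \<forall>g\<in>Ar C. Cod C f = Dom C g \<longrightarrow>
        on_ar F (Cmp C g f) = Cmp D (on_ar F g) (on_ar F f))"

text \<open>The composite \<open>G \<circ> F\<close>, where \<^term>\<open>C\<close> is the source of \<^term>\<open>F\<close>.\<close>

definition fun_comp ::
  "('o, 'm) cat \<Rightarrow> ('p, 'q, 'r, 's) func \<Rightarrow> ('o, 'm, 'p, 'q) func \<Rightarrow> ('o, 'm, 'r, 's) func" where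
  "fun_comp C G F = \<lparr>on_ob = (\<lambda>x\<in>Ob C. on_ob G (on_ob F x)),
     on_ar = (\<lambda>f\<in>Ar C. on_ar G (on_ar F f))\<rparr>"

definition forget :: "'u set set \<Rightarrow> ('u set \<times> 'u, 'u pset_arrow, 'u set, 'u set_arrow) func" where
  "forget S = \<lparr>on_ob = (\<lambda>(X, x)\<in>Ob (pset_cat S). X),
     on_ar = (\<lambda>((X, x), (Y, y), f)\<in>Ar (pset_cat S). (X, Y, f))\<rparr>"

text \<open>For \<open>u : c \<rightarrow> d\<close>, postcomposition with \<^term>\<open>u\<close> as a functor from \<open>C/c\<close> to \<open>C/d\<close>.\<close>

definition slice_comp ::
  "('o, 'm) cat \<Rightarrow> 'm \<Rightarrow> ('m, 'm \<times> 'm \<times> 'm, 'm, 'm \<times> 'm \<times> 'm) func" where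
  "slice_comp C u = \<lparr>on_ob = (\<lambda>f\<in>Ob (slice_cat C (Dom C u)). Cmp C u f),
     on_ar = (\<lambda>(f, g, v)\<in>Ar (slice_cat C (Dom C u)). (Cmp C u f, Cmp C u g, v))\<rparr>"


section \<open>Simplicial sets\<close>

type_synonym 'a sset = "(nat, delta_arrow, 'a set, 'a set_arrow) func"

definition is_sset :: "'a sset \<Rightarrow> bool" where
  "is_sset X \<longleftrightarrow> is_functor (op_cat Delta) (set_cat UNIV) X"

abbreviation simplices :: "'a sset \<Rightarrow> nat \<Rightarrow> 'a set" where
  "simplices X n \<equiv> on_ob X n"

definition act :: "'a sset \<Rightarrow> delta_arrow \<Rightarrow> 'a \<Rightarrow> 'a" where
  "act X \<alpha> = snd (snd (on_ar X \<alpha>))"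

definition mk_sset :: "(nat \<Rightarrow> 'a set) \<Rightarrow> (delta_arrow \<Rightarrow> 'a \<Rightarrow> 'a) \<Rightarrow> 'a sset" where
  "mk_sset X a = \<lparr>on_ob = X,
     on_ar = (\<lambda>\<alpha>\<in>Ar Delta. (X (Cod Delta \<alpha>), X (Dom Delta \<alpha>), restrict (a \<alpha>) (X (Cod Delta \<alpha>))))\<rparr>"

definition is_smap :: "'a sset \<Rightarrow> 'b sset \<Rightarrow> (nat \<Rightarrow> 'a \<Rightarrow> 'b) \<Rightarrow> bool" where
  "is_smap X Y f \<longleftrightarrow> is_sset X \<and> is_sset Y \<and>
     (\<forall>n. f n \<in> simplices X n \<rightarrow>\<^sub>E simplices Y n) \<and>
     (\<forall>\<alpha>\<in>Ar Delta. \<forall>x\<in>simplices X (Cod Delta \<alpha>).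
        f (Dom Delta \<alpha>) (act X \<alpha> x) = act Y \<alpha> (f (Cod Delta \<alpha>) x))"

text \<open>The composite \<open>g \<circ> f\<close>, where \<^term>\<open>X\<close> is the source of \<^term>\<open>f\<close>.\<close>

definition smap_comp ::
  "'a sset \<Rightarrow> (nat \<Rightarrow> 'b \<Rightarrow> 'c) \<Rightarrow> (nat \<Rightarrow> 'a \<Rightarrow> 'b) \<Rightarrow> nat \<Rightarrow> 'a \<Rightarrow> 'c" where
  "smap_comp X g f = (\<lambda>n. compose (simplices X n) (g n) (f n))"

text \<open>Equivalent to left cancellability: \<open>is_mono_cancel\<close> and \<open>is_mono_iff_cancel\<close> below.\<close>

definition is_mono :: "'a sset \<Rightarrow> 'b sset \<Rightarrow> (nat \<Rightarrow> 'a \<Rightarrow> 'b) \<Rightarrow> bool" where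
  "is_mono X Y f \<longleftrightarrow> is_smap X Y f \<and> (\<forall>n. inj_on (f n) (simplices X n))"

definition sub_sset :: "'a sset \<Rightarrow> (nat \<Rightarrow> 'a \<Rightarrow> bool) \<Rightarrow> 'a sset" where
  "sub_sset X P = mk_sset (\<lambda>n. {x \<in> simplices X n. P n x}) (act X)"

definition incl :: "'a sset \<Rightarrow> nat \<Rightarrow> 'a \<Rightarrow> 'a" where
  "incl X = (\<lambda>n. \<lambda>x\<in>simplices X n. x)"

definition fibre_product ::
  "'a sset \<Rightarrow> 'e sset \<Rightarrow> (nat \<Rightarrow> 'a \<Rightarrow> 'b) \<Rightarrow> (nat \<Rightarrow> 'e \<Rightarrow> 'b) \<Rightarrow> ('a \<times> 'e) sset" where
  "fibre_product A E i p =
     mk_sset (\<lambda>n. {(a, e). a \<in> simplices A n \<and> e \<in> simplices E n \<and> i n a = p n e})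
       (\<lambda>\<alpha> (a, e). (act A \<alpha> a, act E \<alpha> e))"

definition proj1 :: "('a \<times> 'e) sset \<Rightarrow> nat \<Rightarrow> 'a \<times> 'e \<Rightarrow> 'a" where
  "proj1 P = (\<lambda>n. \<lambda>x\<in>simplices P n. fst x)"

definition proj2 :: "('a \<times> 'e) sset \<Rightarrow> nat \<Rightarrow> 'a \<times> 'e \<Rightarrow> 'e" where
  "proj2 P = (\<lambda>n. \<lambda>x\<in>simplices P n. snd x)"

text \<open>The square with left map \<open>q : D \<rightarrow> A\<close>, right map \<open>p : E \<rightarrow> B\<close>, top map \<open>j : D \<rightarrow> E\<close> and
  bottom map \<open>i : A \<rightarrow> B\<close> is a pullback if it commutes and the comparison map from \<^term>\<open>D\<close> to
  the fibre product is an isomorphism.  A universal property quantifying over simplicial sets of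
  all types cannot be the body of a definition; \<open>is_pullback_property\<close> and
  \<open>is_pullback_iff_universal\<close> below show that the two notions agree.\<close>

definition is_pullback ::
  "'d sset \<Rightarrow> 'e sset \<Rightarrow> 'a sset \<Rightarrow> 'b sset \<Rightarrow>
   (nat \<Rightarrow> 'd \<Rightarrow> 'e) \<Rightarrow> (nat \<Rightarrow> 'd \<Rightarrow> 'a) \<Rightarrow> (nat \<Rightarrow> 'e \<Rightarrow> 'b) \<Rightarrow> (nat \<Rightarrow> 'a \<Rightarrow> 'b) \<Rightarrow> bool" where
  "is_pullback D E A B j q p i \<longleftrightarrow>
     is_smap D E j \<and> is_smap D A q \<and> is_smap E B p \<and> is_smap A B i \<and>
     smap_comp D i q = smap_comp D p j \<and>
     (\<forall>n. bij_betw (\<lambda>d. (q n d, j n d)) (simplices D n) (simplices (fibre_product A E i p) n))"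


section \<open>Kan fibrations\<close>

definition simplex :: "nat \<Rightarrow> delta_arrow sset" where
  "simplex n = mk_sset (\<lambda>m. {\<beta> \<in> Ar Delta. Dom Delta \<beta> = m \<and> Cod Delta \<beta> = n})
     (\<lambda>\<alpha> \<beta>. Cmp Delta \<beta> \<alpha>)"

text \<open>The horn is the union of the faces opposite to the vertices \<open>i \<noteq> k\<close>; an operator into \<open>[n]\<close>
  lies in the face opposite to \<open>i\<close> iff its image misses \<open>i\<close>.\<close>

definition horn :: "nat \<Rightarrow> nat \<Rightarrow> delta_arrow sset" where
  "horn n k = sub_sset (simplex n) (\<lambda>m (_, _, f). \<exists>i\<le>n. i \<noteq> k \<and> i \<notin> f ` {..m})"

definition kan_fibration :: "'e sset \<Rightarrow> 'b sset \<Rightarrow> (nat \<Rightarrow> 'e \<Rightarrow> 'b) \<Rightarrow> bool" where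
  "kan_fibration E B p \<longleftrightarrow> is_smap E B p \<and>
     (\<forall>n k u v. 1 \<le> n \<and> k \<le> n \<and> is_smap (horn n k) E u \<and> is_smap (simplex n) B v \<and>
        smap_comp (horn n k) p u = smap_comp (horn n k) v (incl (horn n k)) \<longrightarrow>
        (\<exists>w. is_smap (simplex n) E w \<and>
           smap_comp (horn n k) w (incl (horn n k)) = u \<and> smap_comp (simplex n) p w = v))"

definition small_map :: "'k rel \<Rightarrow> 'e sset \<Rightarrow> 'b sset \<Rightarrow> (nat \<Rightarrow> 'e \<Rightarrow> 'b) \<Rightarrow> bool" where
  "small_map \<kappa> E B p \<longleftrightarrow> is_smap E B p \<and>
     (\<forall>n. \<forall>b\<in>simplices B n. |{e \<in> simplices E n. p n e = b}| <o \<kappa>)"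

definition small_kan_fibration :: "'k rel \<Rightarrow> 'e sset \<Rightarrow> 'b sset \<Rightarrow> (nat \<Rightarrow> 'e \<Rightarrow> 'b) \<Rightarrow> bool" where
  "small_kan_fibration \<kappa> E B p \<longleftrightarrow> small_map \<kappa> E B p \<and> kan_fibration E B p"


section \<open>The Hofmann--Streicher universe\<close>

text \<open>The set of objects \<^term>\<open>S\<close> of the full subcategory \<open>set_cat S\<close>.  Every cardinal below
  \<^term>\<open>\<kappa>\<close> is realised by some cardinal order on the carrier type of \<^term>\<open>\<kappa>\<close>.\<close>

definition small_sets :: "'k rel \<Rightarrow> 'u set set \<Rightarrow> bool" where
  "small_sets \<kappa> S \<longleftrightarrow> (\<forall>X\<in>S. |X| <o \<kappa>) \<and>
     (\<forall>c :: 'k rel. Card_order c \<and> c <o \<kappa> \<longrightarrow>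
        (\<exists>X\<in>S. |X| =o c) \<and> |{X \<in> S. |X| =o c}| \<le>o \<kappa>)"

type_synonym ('p, 'q) hs_elt = "(delta_arrow, delta_arrow \<times> delta_arrow \<times> delta_arrow, 'p, 'q) func"

definition hs :: "('p, 'q) cat \<Rightarrow> ('p, 'q) hs_elt sset" where
  "hs D = mk_sset (\<lambda>n. {F. is_functor (op_cat (slice_cat Delta n)) D F})
     (\<lambda>\<alpha> F. fun_comp (op_cat (slice_cat Delta (Dom Delta \<alpha>))) F (slice_comp Delta \<alpha>))"

abbreviation V_base :: "'u set set \<Rightarrow> ('u set, 'u set_arrow) hs_elt sset" where
  "V_base S \<equiv> hs (set_cat S)"

abbreviation V_tilde :: "'u set set \<Rightarrow> ('u set \<times> 'u, 'u pset_arrow) hs_elt sset" where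
  "V_tilde S \<equiv> hs (pset_cat S)"

definition V_proj ::
  "'u set set \<Rightarrow> nat \<Rightarrow> ('u set \<times> 'u, 'u pset_arrow) hs_elt \<Rightarrow> ('u set, 'u set_arrow) hs_elt" where
  "V_proj S = (\<lambda>n. \<lambda>F\<in>simplices (V_tilde S) n.
     fun_comp (op_cat (slice_cat Delta n)) (forget S) F)"

text \<open>The map \<open>\<Delta>\<^sup>n \<rightarrow> X\<close> corresponding to an \<^term>\<open>n\<close>-simplex of \<^term>\<open>X\<close>.\<close>

definition yoneda :: "'a sset \<Rightarrow> nat \<Rightarrow> 'a \<Rightarrow> nat \<Rightarrow> delta_arrow \<Rightarrow> 'a" where
  "yoneda X n x = (\<lambda>m. \<lambda>\<alpha>\<in>simplices (simplex n) m. act X \<alpha> x)"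

definition U_base :: "'u set set \<Rightarrow> ('u set, 'u set_arrow) hs_elt sset" where
  "U_base S = sub_sset (V_base S) (\<lambda>n A.
     let P = fibre_product (simplex n) (V_tilde S) (yoneda (V_base S) n A) (V_proj S)
     in kan_fibration P (simplex n) (proj1 P))"

definition U_tilde ::
  "'u set set \<Rightarrow> (('u set, 'u set_arrow) hs_elt \<times> ('u set \<times> 'u, 'u pset_arrow) hs_elt) sset" where
  "U_tilde S = fibre_product (U_base S) (V_tilde S) (incl (U_base S)) (V_proj S)"

definition U_proj ::
  "'u set set \<Rightarrow> nat \<Rightarrow> ('u set, 'u set_arrow) hs_elt \<times> ('u set \<times> 'u, 'u pset_arrow) hs_elt \<Rightarrow>
   ('u set, 'u set_arrow) hs_elt" where
  "U_proj S = proj1 (U_tilde S)"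


section \<open>The data above are categories, simplicial sets and maps\<close>

lemma Delta_Ar: "\<alpha> \<in> Ar Delta \<longleftrightarrow> (\<exists>m n f. \<alpha> = (m,n,f) \<and> f \<in> {..m} \<rightarrow>\<^sub>E {..n} \<and> mono_on {..m} f)"
  by (auto simp: Delta_def concrete_cat_def)

lemma Delta_simps [simp]:
  "Dom Delta (m,n,f) = m" "Cod Delta (m,n,f) = n" "Idn Delta m = (m,m,\<lambda>x\<in>{..m}. x)"
  "Cmp Delta (n',l,g) (m,n,f) = (m,l,compose {..m} g f)" "Ob Delta = UNIV"
  by (auto simp: Delta_def concrete_cat_def)

lemma Delta_Idn: "Idn Delta m \<in> Ar Delta"
  by (auto simp: Delta_Ar mono_on_def)

lemma Delta_Cmp: assumes "f \<in> Ar Delta" "g \<in> Ar Delta" "Cod Delta f = Dom Delta g" shows "Cmp Delta g f \<in> Ar Delta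
  \<and> Dom Delta (Cmp Delta g f) = Dom Delta f \<and> Cod Delta (Cmp Delta g f) = Cod Delta g"
proof -
  obtain m n F l G where e: "f = (m,n,F)" "g = (n,l,G)" "F \<in> {..m} \<rightarrow>\<^sub>E {..n}" "G \<in> {..n} \<rightarrow>\<^sub>E {..l}" "mono_on {..m} F" "mono_on {..n} G"
    using assms by (auto simp: Delta_Ar)
  have 1: "compose {..m} G F \<in> {..m} \<rightarrow>\<^sub>E {..l}" using e(3,4) by (auto simp: compose_def Pi_def PiE_def)
  have 2: "mono_on {..m} (compose {..m} G F)"
    using e(3,5,6) by (auto simp: compose_def Pi_def PiE_def mono_on_def)
  show ?thesis using 1 2 by (simp add: e Delta_Ar)
qed

lemma Delta_id_left: "f \<in> Ar Delta \<Longrightarrow> Cmp Delta (Idn Delta (Cod Delta f)) f = f"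
  by (auto simp: Delta_Ar compose_def fun_eq_iff PiE_def extensional_def)
lemma Delta_id_right: "f \<in> Ar Delta \<Longrightarrow> Cmp Delta f (Idn Delta (Dom Delta f)) = f"
  by (auto simp: Delta_Ar compose_def fun_eq_iff PiE_def extensional_def)
lemma Delta_assoc: "f \<in> Ar Delta \<Longrightarrow> g \<in> Ar Delta \<Longrightarrow> h \<in> Ar Delta \<Longrightarrow> Cod Delta f = Dom Delta g \<Longrightarrow>
  Cod Delta g = Dom Delta h \<Longrightarrow> Cmp Delta h (Cmp Delta g f) = Cmp Delta (Cmp Delta h g) f"
  by (auto simp: Delta_Ar compose_def fun_eq_iff PiE_def extensional_def Pi_def)

lemma is_sset_mk:
  assumes "\<And>\<alpha> x. \<alpha> \<in> Ar Delta \<Longrightarrow> x \<in> X (Cod Delta \<alpha>) \<Longrightarrow> a \<alpha> x \<in> X (Dom Delta \<alpha>)"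
    and "\<And>n x. x \<in> X n \<Longrightarrow> a (Idn Delta n) x = x"
    and "\<And>\<alpha> \<beta> x. \<alpha> \<in> Ar Delta \<Longrightarrow> \<beta> \<in> Ar Delta \<Longrightarrow> Cod Delta \<alpha> = Dom Delta \<beta> \<Longrightarrow> x \<in> X (Cod Delta \<beta>) \<Longrightarrow>
       a (Cmp Delta \<beta> \<alpha>) x = a \<alpha> (a \<beta> x)"
  shows "is_sset (mk_sset X a)"
proof -
  let ?F = "mk_sset X a"
  have 1: "on_ar ?F \<alpha> \<in> Ar (set_cat UNIV)" if "\<alpha> \<in> Ar Delta" for \<alpha>
    using assms(1)[OF that] that by (auto simp: mk_sset_def set_cat_def concrete_cat_def)
  have 2: "on_ar ?F (Idn Delta n) = Idn (set_cat UNIV) (X n)" for n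
    using Delta_Idn[of n] assms(2)[of _ n]
    by (auto simp: mk_sset_def set_cat_def concrete_cat_def fun_eq_iff restrict_def)
  have 3: "on_ar ?F (Cmp Delta g f) = Cmp (set_cat UNIV) (on_ar ?F f) (on_ar ?F g)"
    if "f \<in> Ar Delta" "g \<in> Ar Delta" "Cod Delta f = Dom Delta g" for f g
    using Delta_Cmp[OF that] that assms(3)[OF that] assms(1)[OF that(2)]
    by (auto simp: mk_sset_def set_cat_def concrete_cat_def fun_eq_iff restrict_def compose_def simp del: Delta_simps)
  have 4: "Dom (set_cat UNIV) (on_ar ?F f) = X (Cod Delta f)" "Cod (set_cat UNIV) (on_ar ?F f) = X (Dom Delta f)"
    if "f \<in> Ar Delta" for f
    using that by (auto simp: mk_sset_def set_cat_def concrete_cat_def)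
  have 5: "on_ob ?F = X" "on_ar ?F \<in> extensional (Ar Delta)"  by (auto simp: mk_sset_def)
  have 6: "Ob (set_cat UNIV) = UNIV" by (simp add: set_cat_def concrete_cat_def)
  have 7: "on_ob ?F \<in> UNIV \<rightarrow>\<^sub>E UNIV" "on_ar ?F \<in> Ar Delta \<rightarrow>\<^sub>E Ar (set_cat UNIV)"
    using 1 5(2) by (auto simp: PiE_def)
  show ?thesis unfolding is_sset_def is_functor_def op_cat_def cat.simps Delta_simps(5) 6 
    by (intro conjI 7 ballI impI) (simp_all only: 2 3 4 5(1))
qed

lemma mk_sset_simps [simp]: "simplices (mk_sset X a) = X"
   "\<alpha> \<in> Ar Delta \<Longrightarrow> x \<in> X (Cod Delta \<alpha>) \<Longrightarrow> act (mk_sset X a) \<alpha> x = a \<alpha> x"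
  by (auto simp: mk_sset_def act_def)

lemma act_on_ar: assumes "is_sset X" "\<alpha> \<in> Ar Delta"
  shows "on_ar X \<alpha> = (on_ob X (Cod Delta \<alpha>), on_ob X (Dom Delta \<alpha>), act X \<alpha>)"
   and "act X \<alpha> \<in> simplices X (Cod Delta \<alpha>) \<rightarrow>\<^sub>E simplices X (Dom Delta \<alpha>)"
proof -
  have 1: "on_ar X \<alpha> \<in> Ar (set_cat UNIV)" "Dom (set_cat UNIV) (on_ar X \<alpha>) = on_ob X (Cod Delta \<alpha>)"
     "Cod (set_cat UNIV) (on_ar X \<alpha>) = on_ob X (Dom Delta \<alpha>)"
    using assms unfolding is_sset_def is_functor_def op_cat_def cat.simps by blast+
  show "on_ar X \<alpha> = (on_ob X (Cod Delta \<alpha>), on_ob X (Dom Delta \<alpha>), act X \<alpha>)"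
   and "act X \<alpha> \<in> simplices X (Cod Delta \<alpha>) \<rightarrow>\<^sub>E simplices X (Dom Delta \<alpha>)"
    unfolding act_def using 1 by (cases "on_ar X \<alpha>"; simp add: set_cat_def concrete_cat_def)+
qed

lemma act_mem: "is_sset X \<Longrightarrow> \<alpha> \<in> Ar Delta \<Longrightarrow> x \<in> simplices X (Cod Delta \<alpha>) \<Longrightarrow> act X \<alpha> x \<in> simplices X (Dom Delta \<alpha>)"
  using act_on_ar(2) by fastforce

lemma act_Idn: assumes X: "is_sset X" and "x \<in> simplices X n" shows "act X (Idn Delta n) x = x"
proof -
  have "on_ar X (Idn Delta n) = Idn (set_cat UNIV) (on_ob X n)"
    using X unfolding is_sset_def is_functor_def op_cat_def cat.simps Delta_simps(5) by blast
  then show ?thesis using assms by (simp add: act_def set_cat_def concrete_cat_def)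
qed

lemma act_Cmp: assumes X: "is_sset X" and ab: "\<alpha> \<in> Ar Delta" "\<beta> \<in> Ar Delta" "Cod Delta \<alpha> = Dom Delta \<beta>"
   and x: "x \<in> simplices X (Cod Delta \<beta>)"
 shows "act X (Cmp Delta \<beta> \<alpha>) x = act X \<alpha> (act X \<beta> x)"
proof -
  have "on_ar X (Cmp Delta \<beta> \<alpha>) = Cmp (set_cat UNIV) (on_ar X \<alpha>) (on_ar X \<beta>)"
    using X[unfolded is_sset_def is_functor_def, THEN conjunct2, THEN conjunct2, THEN conjunct2, THEN conjunct2,
        unfolded op_cat_def cat.simps, rule_format, OF ab(2,1) ab(3)[symmetric]] .
  then have "act X (Cmp Delta \<beta> \<alpha>) = compose (simplices X (Cod Delta \<beta>)) (act X \<alpha>) (act X \<beta>)"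
    unfolding act_on_ar(1)[OF X ab(1)] act_on_ar(1)[OF X ab(2)] act_def[of X "Cmp Delta \<beta> \<alpha>"]
    by (simp add: set_cat_def concrete_cat_def)
  then show ?thesis using x by (simp add: compose_def)
qed

lemma is_sset_simplex: "is_sset (simplex n)"
  unfolding simplex_def
proof (rule is_sset_mk, unfold mem_Collect_eq, goal_cases)
  case (1 \<alpha> x) then show ?case using Delta_Cmp[of \<alpha> x] by metis
next
  case (2 n x) then show ?case using Delta_id_right[of x] by metis
next
  case (3 \<alpha> \<beta> x) then show ?case using Delta_assoc[of \<alpha> \<beta> x] by metis
qed

lemma is_cat_Delta: "is_cat Delta"
  unfolding is_cat_def
proof (intro conjI ballI impI, goal_cases)
  case (4 f) show ?case by simp next
  case (5 f) show ?case by simp next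
  case (6 f g) then show ?case using Delta_Cmp by blast next
  case (7 f g) then show ?case using Delta_Cmp by blast next
  case (8 f g) then show ?case using Delta_Cmp by blast next
  case (9 f) then show ?case using Delta_id_left by blast next
  case (10 f) then show ?case using Delta_id_right by blast next
  case (11 f g h) then show ?case by (rule Delta_assoc) 
qed (simp_all add: Delta_Idn[simplified])

lemma is_cat_slice: assumes C: "is_cat (C::('o,'m) cat)" shows "is_cat (slice_cat C n)"
proof -
  note C' = C[unfolded is_cat_def]
  have 1: "Idn C x \<in> Ar C \<and> Dom C (Idn C x) = x \<and> Cod C (Idn C x) = x" if "x \<in> Ob C" for x using C' that by blast
  have 2: "Dom C f \<in> Ob C" "Cod C f \<in> Ob C" if "f \<in> Ar C" for f using C' that by blast+
  have 3: "Cmp C g f \<in> Ar C \<and> Dom C (Cmp C g f) = Dom C f \<and> Cod C (Cmp C g f) = Cod C g"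
    if "f \<in> Ar C" "g \<in> Ar C" "Cod C f = Dom C g" for f g using C' that by blast
  have 4: "Cmp C (Idn C (Cod C f)) f = f \<and> Cmp C f (Idn C (Dom C f)) = f" if "f \<in> Ar C" for f
    using C' that by blast
  have 5: "Cmp C h (Cmp C g f) = Cmp C (Cmp C h g) f" if "f \<in> Ar C" "g \<in> Ar C" "h \<in> Ar C" "Cod C f = Dom C g" "Cod C g = Dom C h" for f g h
    using C' that by blast
  have 41: "Cmp C (Idn C y) f = f" if "f \<in> Ar C" "y = Cod C f" for f y
    using 4 that by blast
  have 42: "Cmp C f (Idn C y) = f" if "f \<in> Ar C" "y = Dom C f" for f y
    using 4 that by blast
  show ?thesis unfolding is_cat_def slice_cat_def
    apply (intro conjI ballI impI)
    subgoal for x using 1[of "Dom C x"] 2[of x] 42[of x] by simp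
    subgoal by simp
    subgoal by simp
    subgoal by auto
    subgoal by auto
    subgoal for f g by (cases f; cases g) (simp add: 3 5)
    subgoal by auto
    subgoal by auto
    subgoal for f by (cases f) (simp add: 41)
    subgoal for f by (cases f) (simp add: 42)
    subgoal for f g h by (cases f; cases g; cases h) (simp add: 5)
    done
qed

lemma slice_closed:
  assumes "f \<in> Ar (slice_cat Delta n)" "g \<in> Ar (slice_cat Delta n)" "Cod (slice_cat Delta n) f = Dom (slice_cat Delta n) g"
  shows "Cmp (slice_cat Delta n) g f \<in> Ar (slice_cat Delta n)"
  using assms is_cat_slice[OF is_cat_Delta, of n] unfolding is_cat_def by blast

lemma slice_Idn: "f \<in> Ob (slice_cat Delta n) \<Longrightarrow> Idn (slice_cat Delta n) f \<in> Ar (slice_cat Delta n)"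
  using is_cat_slice[OF is_cat_Delta, of n] unfolding is_cat_def by blast

lemma slice_comp_functor_gen:
  fixes C :: "('o,'m) cat"
  assumes C: "is_cat C" and a: "\<alpha> \<in> Ar C"
  shows "is_functor (slice_cat C (Dom C \<alpha>)) (slice_cat C (Cod C \<alpha>)) (slice_comp C \<alpha>)"
proof -
  note C' = C[unfolded is_cat_def]
  have 3: "Cmp C \<alpha> f \<in> Ar C \<and> Dom C (Cmp C \<alpha> f) = Dom C f \<and> Cod C (Cmp C \<alpha> f) = Cod C \<alpha>"
    if "f \<in> Ar C" "Cod C f = Dom C \<alpha>" for f using C' that a by blast
  have 5: "Cmp C \<alpha> (Cmp C g f) = Cmp C (Cmp C \<alpha> g) f" if "f \<in> Ar C" "g \<in> Ar C" "Cod C f = Dom C g" "Cod C g = Dom C \<alpha>" for f g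
    using C' that a by blast
  have 6: "Idn (slice_cat C n) f \<in> Ar (slice_cat C n)" if "f \<in> Ob (slice_cat C n)" for f n
    using is_cat_slice[OF C, of n] that unfolding is_cat_def by blast
  have 7: "Cmp (slice_cat C n) g f \<in> Ar (slice_cat C n)" if "f \<in> Ar (slice_cat C n)" "g \<in> Ar (slice_cat C n)"
     "Cod (slice_cat C n) f = Dom (slice_cat C n) g" for f g n
    using is_cat_slice[OF C, of n] that unfolding is_cat_def by blast
  show ?thesis
    unfolding is_functor_def
    apply (intro conjI ballI impI)
    subgoal by (rule PiE_I) (auto simp add: slice_cat_def slice_comp_def 3)
    subgoal apply (rule PiE_I)
      subgoal for t by (cases t) (simp add: slice_cat_def slice_comp_def 3 5[symmetric])
      subgoal for t by (simp add: slice_comp_def)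
      done
    subgoal for f by (cases f) (simp add: slice_cat_def slice_comp_def)
    subgoal for f by (cases f) (simp add: slice_cat_def slice_comp_def)
    subgoal for x apply (frule 6) apply (simp add: slice_comp_def) by (simp add: slice_cat_def 3)
    subgoal for f g apply (frule (2) 7) apply (simp add: slice_comp_def) apply (cases f; cases g) by (simp add: slice_cat_def)
    done
qed

lemmas slice_comp_functor = slice_comp_functor_gen[OF is_cat_Delta]

lemma hs_id:
  fixes C :: "('o,'m) cat"
  assumes C: "is_cat C" and n: "n \<in> Ob C" and a: "is_functor (op_cat (slice_cat C n)) D F"
  shows "fun_comp (op_cat (slice_cat C n)) F (slice_comp C (Idn C n)) = F"
proof -
  have i: "Cmp C (Idn C n) f = f" if "f \<in> Ar C" "Cod C f = n" for f using C that unfolding is_cat_def by blast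
  have d: "Dom C (Idn C n) = n" using C n unfolding is_cat_def by blast
  have "on_ob F \<in> extensional (Ob (slice_cat C n))" "on_ar F \<in> extensional (Ar (slice_cat C n))"
    using a by (simp_all add: is_functor_def op_cat_def PiE_def)
  then have "on_ob (fun_comp (op_cat (slice_cat C n)) F (slice_comp C (Idn C n))) = on_ob F"
    "on_ar (fun_comp (op_cat (slice_cat C n)) F (slice_comp C (Idn C n))) = on_ar F"
    by (auto simp: fun_comp_def slice_comp_def op_cat_def fun_eq_iff restrict_def extensional_def d slice_cat_def i)
  then show ?thesis by simp
qed

lemma hs_cmp:
  fixes C :: "('o,'m) cat"
  assumes C: "is_cat C" and a: "\<alpha> \<in> Ar C" "\<beta> \<in> Ar C" "Cod C \<alpha> = Dom C \<beta>"
  shows "fun_comp (op_cat (slice_cat C (Dom C (Cmp C \<beta> \<alpha>)))) F (slice_comp C (Cmp C \<beta> \<alpha>)) =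
        fun_comp (op_cat (slice_cat C (Dom C \<alpha>)))
          (fun_comp (op_cat (slice_cat C (Dom C \<beta>))) F (slice_comp C \<beta>)) (slice_comp C \<alpha>)"
proof -
  have i: "Cmp C (Cmp C \<beta> \<alpha>) f = Cmp C \<beta> (Cmp C \<alpha> f)" if "f \<in> Ar C" "Cod C f = Dom C \<alpha>" for f
    using C that a unfolding is_cat_def by metis
  have d: "Dom C (Cmp C \<beta> \<alpha>) = Dom C \<alpha>" using C a unfolding is_cat_def by blast
  have f: "x \<in> Ob (slice_cat C (Dom C \<alpha>)) \<Longrightarrow> on_ob (slice_comp C \<alpha>) x \<in> Ob (slice_cat C (Dom C \<beta>))"
     "y \<in> Ar (slice_cat C (Dom C \<alpha>)) \<Longrightarrow> on_ar (slice_comp C \<alpha>) y \<in> Ar (slice_cat C (Dom C \<beta>))" for x y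
    using slice_comp_functor_gen[OF C a(1)] a(3) unfolding is_functor_def by auto
  have o: "on_ob (slice_comp C (Cmp C \<beta> \<alpha>)) x = on_ob (slice_comp C \<beta>) (on_ob (slice_comp C \<alpha>) x)"
    if "x \<in> Ob (slice_cat C (Dom C \<alpha>))" for x
    using f(1)[OF that] that by (auto simp: slice_comp_def d i slice_cat_def)
  have r: "on_ar (slice_comp C (Cmp C \<beta> \<alpha>)) x = on_ar (slice_comp C \<beta>) (on_ar (slice_comp C \<alpha>) x)"
    if "x \<in> Ar (slice_cat C (Dom C \<alpha>))" for x
    using f(2)[OF that] that by (auto simp: slice_comp_def d i slice_cat_def)
  show ?thesis using o r f by (auto simp: fun_comp_def d op_cat_def fun_eq_iff restrict_def)
qed

lemma is_functor_op: "is_functor C D F \<Longrightarrow> is_functor (op_cat C) (op_cat D) F"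
  by (auto simp: is_functor_def op_cat_def)

lemma is_functor_comp:
  assumes C: "\<And>x. x \<in> Ob C \<Longrightarrow> Idn C x \<in> Ar C" "\<And>f. f \<in> Ar C \<Longrightarrow> Dom C f \<in> Ob C \<and> Cod C f \<in> Ob C"
     "\<And>f g. f \<in> Ar C \<Longrightarrow> g \<in> Ar C \<Longrightarrow> Cod C f = Dom C g \<Longrightarrow> Cmp C g f \<in> Ar C"
   and F: "is_functor C D F" and G: "is_functor D E G"
  shows "is_functor C E (fun_comp C G F)"
proof -
  note F' = F[unfolded is_functor_def] and G' = G[unfolded is_functor_def]
  have o: "x \<in> Ob C \<Longrightarrow> on_ob F x \<in> Ob D" "y \<in> Ob D \<Longrightarrow> on_ob G y \<in> Ob E"
     "f \<in> Ar C \<Longrightarrow> on_ar F f \<in> Ar D" "g \<in> Ar D \<Longrightarrow> on_ar G g \<in> Ar E" for x y f g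
    using F' G' by blast+
  show ?thesis unfolding is_functor_def fun_comp_def
    using o C F' G' by (simp add: Pi_def)
qed

lemma slice_DC: "f \<in> Ar (slice_cat Delta n) \<Longrightarrow> Dom (slice_cat Delta n) f \<in> Ob (slice_cat Delta n) \<and> Cod (slice_cat Delta n) f \<in> Ob (slice_cat Delta n)"
  by (auto simp: slice_cat_def)

lemma is_sset_hs: fixes D :: "('p,'q) cat" shows "is_sset (hs D)"
  unfolding hs_def
proof (rule is_sset_mk, unfold mem_Collect_eq)
  fix \<alpha> and F :: "('p,'q) hs_elt"
  assume a: "\<alpha> \<in> Ar Delta" "is_functor (op_cat (slice_cat Delta (Cod Delta \<alpha>))) D F"
  show "is_functor (op_cat (slice_cat Delta (Dom Delta \<alpha>))) D
        (fun_comp (op_cat (slice_cat Delta (Dom Delta \<alpha>))) F (slice_comp Delta \<alpha>))"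
    apply (rule is_functor_comp[OF _ _ _ is_functor_op[OF slice_comp_functor[OF a(1)]] a(2)])
    using slice_closed slice_DC slice_Idn by (auto simp: op_cat_def)
next
  fix n and F :: "('p,'q) hs_elt"
  assume a: "is_functor (op_cat (slice_cat Delta n)) D F"
  show "fun_comp (op_cat (slice_cat Delta (Dom Delta (Idn Delta n)))) F (slice_comp Delta (Idn Delta n)) = F"
    using hs_id[OF is_cat_Delta _ a] by simp
next
  fix \<alpha> \<beta> and F :: "('p,'q) hs_elt"
  assume a: "\<alpha> \<in> Ar Delta" "\<beta> \<in> Ar Delta" "Cod Delta \<alpha> = Dom Delta \<beta>"
     "is_functor (op_cat (slice_cat Delta (Cod Delta \<beta>))) D F"
  show "fun_comp (op_cat (slice_cat Delta (Dom Delta (Cmp Delta \<beta> \<alpha>)))) F (slice_comp Delta (Cmp Delta \<beta> \<alpha>)) =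
        fun_comp (op_cat (slice_cat Delta (Dom Delta \<alpha>)))
          (fun_comp (op_cat (slice_cat Delta (Dom Delta \<beta>))) F (slice_comp Delta \<beta>)) (slice_comp Delta \<alpha>)"
    by (rule hs_cmp[OF is_cat_Delta a(1-3)])
qed


lemma is_sset_fibre_product:
  assumes i: "is_smap A B i" and p: "is_smap E B p" shows "is_sset (fibre_product A E i p)"
  unfolding fibre_product_def
proof (rule is_sset_mk)
  have A: "is_sset A" and E: "is_sset E" using assms by (auto simp: is_smap_def)
  show "(case x of (a, e) \<Rightarrow> (act A \<alpha> a, act E \<alpha> e))
      \<in> {(a, e). a \<in> simplices A (Dom Delta \<alpha>) \<and> e \<in> simplices E (Dom Delta \<alpha>) \<and>
           i (Dom Delta \<alpha>) a = p (Dom Delta \<alpha>) e}"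
    if "\<alpha> \<in> Ar Delta"  "x \<in> {(a, e). a \<in> simplices A (Cod Delta \<alpha>) \<and> e \<in> simplices E (Cod Delta \<alpha>) \<and>
           i (Cod Delta \<alpha>) a = p (Cod Delta \<alpha>) e}" for \<alpha> x
    using that act_mem[OF A that(1)] act_mem[OF E that(1)] i p by (auto simp: is_smap_def)
  show "(case x of (a, e) \<Rightarrow> (act A (Idn Delta n) a, act E (Idn Delta n) e)) = x"
    if "x \<in> {(a, e). a \<in> simplices A n \<and> e \<in> simplices E n \<and> i n a = p n e}" for n x
    using that act_Idn[OF A] act_Idn[OF E] by (auto simp del: Delta_simps)
  show "(case x of (a, e) \<Rightarrow> (act A (Cmp Delta \<beta> \<alpha>) a, act E (Cmp Delta \<beta> \<alpha>) e)) =
       (case case x of (a, e) \<Rightarrow> (act A \<beta> a, act E \<beta> e) of (a, e) \<Rightarrow> (act A \<alpha> a, act E \<alpha> e))"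
    if "\<alpha> \<in> Ar Delta" "\<beta> \<in> Ar Delta" "Cod Delta \<alpha> = Dom Delta \<beta>"
     "x \<in> {(a, e). a \<in> simplices A (Cod Delta \<beta>) \<and> e \<in> simplices E (Cod Delta \<beta>) \<and>
           i (Cod Delta \<beta>) a = p (Cod Delta \<beta>) e}" for \<alpha> \<beta> x
    using that act_Cmp[OF A that(1-3)] act_Cmp[OF E that(1-3)] by (auto simp del: Delta_simps)
qed

lemma smap_mem: "is_smap X Y f \<Longrightarrow> x \<in> simplices X n \<Longrightarrow> f n x \<in> simplices Y n"
  by (auto simp: is_smap_def)

lemma smap_act: "is_smap X Y f \<Longrightarrow> \<alpha> \<in> Ar Delta \<Longrightarrow> x \<in> simplices X (Cod Delta \<alpha>) \<Longrightarrow>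
   f (Dom Delta \<alpha>) (act X \<alpha> x) = act Y \<alpha> (f (Cod Delta \<alpha>) x)"
  by (auto simp: is_smap_def)

lemma smap_eqI: "is_smap X Y f \<Longrightarrow> is_smap X Y g \<Longrightarrow> (\<And>n x. x \<in> simplices X n \<Longrightarrow> f n x = g n x) \<Longrightarrow> f = g"
  unfolding is_smap_def by (intro ext) (metis PiE_ext)

lemma smap_comp_app [simp]: "x \<in> simplices X n \<Longrightarrow> smap_comp X g f n x = g n (f n x)"
  by (simp add: smap_comp_def compose_def)

lemma smap_comp_smap: "is_smap X Y f \<Longrightarrow> is_smap Y Z g \<Longrightarrow> is_smap X Z (smap_comp X g f)"
proof -
  assume f: "is_smap X Y f" and g: "is_smap Y Z g"
  have X: "is_sset X" "is_sset Z" using f g by (auto simp: is_smap_def)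
  show ?thesis unfolding is_smap_def
  proof (intro conjI X allI ballI)
    show "smap_comp X g f n \<in> simplices X n \<rightarrow>\<^sub>E simplices Z n" for n
      using smap_mem[OF f] smap_mem[OF g] by (auto simp: smap_comp_def compose_def)
    fix \<alpha> x assume a: "\<alpha> \<in> Ar Delta" "x \<in> simplices X (Cod Delta \<alpha>)"
    show "smap_comp X g f (Dom Delta \<alpha>) (act X \<alpha> x) = act Z \<alpha> (smap_comp X g f (Cod Delta \<alpha>) x)"
      using act_mem[OF X(1) a] a smap_act[OF f a] smap_act[OF g a(1) smap_mem[OF f a(2)]] by simp
  qed
qed

lemma smap_comp_cong: "smap_comp X g f = smap_comp X g' f' \<longleftrightarrow> (\<forall>n. \<forall>x\<in>simplices X n. g n (f n x) = g' n (f' n x))"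
  by (auto simp: smap_comp_def compose_def fun_eq_iff restrict_def)

lemma is_smap_id: "is_sset X \<Longrightarrow> is_smap X X (\<lambda>n. \<lambda>x\<in>simplices X n. x)"
  unfolding is_smap_def by (intro conjI allI ballI) (simp_all add: act_mem)

lemma is_smap_proj:
  assumes i: "is_smap A B i" and p: "is_smap E B p"
  shows "is_smap (fibre_product A E i p) A (proj1 (fibre_product A E i p))"
    "is_smap (fibre_product A E i p) E (proj2 (fibre_product A E i p))"
proof -
  let ?P = "fibre_product A E i p"
  have P: "is_sset ?P" by (rule is_sset_fibre_product[OF assms])
  have S: "simplices ?P n = {(a, e). a \<in> simplices A n \<and> e \<in> simplices E n \<and> i n a = p n e}" for n
    by (simp add: fibre_product_def)
  have a: "act ?P \<alpha> x = (act A \<alpha> (fst x), act E \<alpha> (snd x))" if "\<alpha> \<in> Ar Delta" "x \<in> simplices ?P (Cod Delta \<alpha>)" for \<alpha> x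
    using that unfolding S by (subst fibre_product_def) (auto)
  show "is_smap ?P A (proj1 ?P)" "is_smap ?P E (proj2 ?P)"
    using assms P act_mem[OF P] a unfolding is_smap_def proj1_def proj2_def
    by (auto simp: S)
qed

text \<open>The universal property of the square, tested on \<^term>\<open>T\<close>.\<close>

definition pullback_property ::
  "'t sset \<Rightarrow> 'd sset \<Rightarrow> 'e sset \<Rightarrow> 'a sset \<Rightarrow> 'b sset \<Rightarrow>
   (nat \<Rightarrow> 'd \<Rightarrow> 'e) \<Rightarrow> (nat \<Rightarrow> 'd \<Rightarrow> 'a) \<Rightarrow> (nat \<Rightarrow> 'e \<Rightarrow> 'b) \<Rightarrow> (nat \<Rightarrow> 'a \<Rightarrow> 'b) \<Rightarrow> bool" where
  "pullback_property T D E A B j q p i \<longleftrightarrow>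
     (\<forall>u v. is_smap T E u \<and> is_smap T A v \<and> smap_comp T i v = smap_comp T p u \<longrightarrow>
       (\<exists>!w. is_smap T D w \<and> smap_comp T j w = u \<and> smap_comp T q w = v))"

lemma is_pullback_property:
  fixes T :: "'t sset"
  assumes "is_pullback D E A B j q p i" shows "pullback_property T D E A B j q p i"
  unfolding pullback_property_def
proof (intro allI impI)
  fix u v assume uv: "is_smap T E u \<and> is_smap T A v \<and> smap_comp T i v = smap_comp T p u"
  have S: "simplices (fibre_product A E i p) n = {(a, e). a \<in> simplices A n \<and> e \<in> simplices E n \<and> i n a = p n e}" for n
    by (simp add: fibre_product_def)
  note as = assms[unfolded is_pullback_def S smap_comp_cong]
  have jq: "is_smap D E j" "is_smap D A q" using as by auto
  have T: "is_sset T" and D: "is_sset D" using uv as by (auto simp: is_smap_def)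
  have b: "bij_betw (\<lambda>d. (q n d, j n d)) (simplices D n) {(a, e). a \<in> simplices A n \<and> e \<in> simplices E n \<and> i n a = p n e}" for n
    using as by blast
  have inj: "d = d'" if "d \<in> simplices D n" "d' \<in> simplices D n" "q n d = q n d'" "j n d = j n d'" for d d' n
    using that b[of n] unfolding bij_betw_def inj_on_def by auto
  have ex: "\<exists>d\<in>simplices D n. q n d = v n t \<and> j n d = u n t" if "t \<in> simplices T n" for n t
  proof -
    have "(v n t, u n t) \<in> {(a, e). a \<in> simplices A n \<and> e \<in> simplices E n \<and> i n a = p n e}"
      using uv that by (auto simp: smap_mem smap_comp_cong)
    then have "(v n t, u n t) \<in> (\<lambda>d. (q n d, j n d)) ` simplices D n" using b[of n] unfolding bij_betw_def by blast
    then show ?thesis by auto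
  qed
  define w where "w n = (\<lambda>t\<in>simplices T n. SOME d. d \<in> simplices D n \<and> q n d = v n t \<and> j n d = u n t)" for n
  have w: "w n t \<in> simplices D n" "q n (w n t) = v n t" "j n (w n t) = u n t" if t: "t \<in> simplices T n" for n t
    using someI_ex[OF ex[OF t, unfolded Bex_def]] t unfolding w_def by auto
  have wm: "is_smap T D w"
    unfolding is_smap_def
  proof (intro conjI T D allI ballI)
    show "w n \<in> simplices T n \<rightarrow>\<^sub>E simplices D n" for n using w(1) by (auto simp: w_def)
    fix \<alpha> t assume a: "\<alpha> \<in> Ar Delta" "t \<in> simplices T (Cod Delta \<alpha>)"
    note m = act_mem[OF T a] act_mem[OF D a(1) w(1)[OF a(2)]]
    show "w (Dom Delta \<alpha>) (act T \<alpha> t) = act D \<alpha> (w (Cod Delta \<alpha>) t)"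
      apply (rule inj[OF w(1)[OF m(1)] m(2)])
      using w[OF m(1)] w[OF a(2)] uv a smap_act[OF jq(1) a(1)] smap_act[OF jq(2) a(1)]
      by (auto simp: smap_act)
  qed
  show "\<exists>!w. is_smap T D w \<and> smap_comp T j w = u \<and> smap_comp T q w = v"
  proof (rule ex1I[of _ w], intro conjI wm)
    show "smap_comp T j w = u" "smap_comp T q w = v"
      using w uv by (auto intro!: smap_eqI smap_comp_smap[OF wm] jq)
    fix w' assume w': "is_smap T D w' \<and> smap_comp T j w' = u \<and> smap_comp T q w' = v"
    show "w' = w"
    proof (rule smap_eqI[OF _ wm])
      show "is_smap T D w'" using w' by simp
      fix n x assume x: "x \<in> simplices T n"
      show "w' n x = w n x"
        apply (rule inj) using x w[OF x] w' smap_mem[of T D w', OF _ x] by auto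
    qed
  qed
qed

lemma is_pullback_iff_universal:
  fixes D :: "'d sset" and E :: "'e sset" and A :: "'a sset"
  shows "is_pullback D E A B j q p i \<longleftrightarrow>
    is_smap D E j \<and> is_smap D A q \<and> is_smap E B p \<and> is_smap A B i \<and> smap_comp D i q = smap_comp D p j \<and>
    (\<forall>T :: 'd sset. pullback_property T D E A B j q p i) \<and> (\<forall>T :: ('a \<times> 'e) sset. pullback_property T D E A B j q p i)"
  (is "_ \<longleftrightarrow> ?R")
proof
  assume P: "is_pullback D E A B j q p i"
  show ?R using P[unfolded is_pullback_def] is_pullback_property[OF P, where T="T :: 'd sset" for T] is_pullback_property[OF P, where T="T :: ('a \<times> 'e) sset" for T] by blast
next
  assume R: ?R
  let ?P = "fibre_product A E i p"
  have S: "simplices ?P n = {(a, e). a \<in> simplices A n \<and> e \<in> simplices E n \<and> i n a = p n e}" for n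
    by (simp add: fibre_product_def)
  have P: "is_smap ?P A (proj1 ?P)" "is_smap ?P E (proj2 ?P)" using is_smap_proj R by blast+
  have "smap_comp ?P i (proj1 ?P) = smap_comp ?P p (proj2 ?P)"
    by (auto simp: smap_comp_cong S proj1_def proj2_def)
  with R P obtain w where w: "is_smap ?P D w" "smap_comp ?P j w = proj2 ?P" "smap_comp ?P q w = proj1 ?P"
    unfolding pullback_property_def by metis
  have w': "q n (w n x) = fst x" "j n (w n x) = snd x" if "x \<in> simplices ?P n" for x n
    using fun_cong[OF fun_cong[OF w(2)], of n x] fun_cong[OF fun_cong[OF w(3)], of n x] that
    by (auto simp: proj1_def proj2_def)
  have inj: "inj_on (\<lambda>d. (q n d, j n d)) (simplices D n)" for n
  proof (rule inj_onI)
    define c where "c n = (\<lambda>d\<in>simplices D n. w n (q n d, j n d))" for n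
    let ?I = "\<lambda>n. \<lambda>x\<in>simplices D n. x"
    have m: "(q n d, j n d) \<in> simplices ?P n" if "d \<in> simplices D n" for n d
      using R that by (auto simp: S smap_mem smap_comp_cong)
    have D: "is_sset D" using R by (simp add: is_smap_def)
    have cs: "is_smap D D c"
      unfolding is_smap_def
    proof (intro conjI D allI ballI)
      show "c n \<in> simplices D n \<rightarrow>\<^sub>E simplices D n" for n using smap_mem[OF w(1) m] by (auto simp: c_def)
      fix \<alpha> t assume a: "\<alpha> \<in> Ar Delta" "t \<in> simplices D (Cod Delta \<alpha>)"
      have "act ?P \<alpha> (q (Cod Delta \<alpha>) t, j (Cod Delta \<alpha>) t) = (act A \<alpha> (q (Cod Delta \<alpha>) t), act E \<alpha> (j (Cod Delta \<alpha>) t))"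
        using m[OF a(2)] a unfolding S by (subst fibre_product_def) auto
      then show "c (Dom Delta \<alpha>) (act D \<alpha> t) = act D \<alpha> (c (Cod Delta \<alpha>) t)"
        using a act_mem[OF D a] smap_act[OF w(1) a(1) m[OF a(2)]] smap_act[of D E j, OF _ a] smap_act[of D A q, OF _ a] R
        by (auto simp: c_def)
    qed
    have "\<exists>!w. is_smap D D w \<and> smap_comp D j w = j \<and> smap_comp D q w = q"
      using R unfolding pullback_property_def by blast
    moreover have "smap_comp D j c = j" "smap_comp D q c = q" "smap_comp D j ?I = j" "smap_comp D q ?I = q"
      using R m w'[OF m] by (auto intro!: smap_eqI smap_comp_smap[OF cs] smap_comp_smap[OF is_smap_id[OF D]] simp: c_def)
    ultimately have eq: "c = ?I" using cs is_smap_id[OF D] by auto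
    fix x y assume "x \<in> simplices D n" "y \<in> simplices D n" "(q n x, j n x) = (q n y, j n y)"
    then show "x = y" using fun_cong[OF fun_cong[OF eq], of n x] fun_cong[OF fun_cong[OF eq], of n y]
      by (auto simp: c_def)
  qed
  have "(\<lambda>d. (q n d, j n d)) ` simplices D n = simplices ?P n" for n
  proof
    show "(\<lambda>d. (q n d, j n d)) ` simplices D n \<subseteq> simplices ?P n"
      using R by (auto simp: S smap_mem smap_comp_cong)
    show "simplices ?P n \<subseteq> (\<lambda>d. (q n d, j n d)) ` simplices D n"
      using w' smap_mem[OF w(1)] by (force simp: image_iff)
  qed
  then show "is_pullback D E A B j q p i"
    using R inj by (auto simp: is_pullback_def bij_betw_def)
qed

lemma is_mono_cancel:
  assumes "is_mono X Y f" "is_smap T X u" "is_smap T X v" "smap_comp T f u = smap_comp T f v"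
  shows "u = v"
  apply (rule smap_eqI[OF assms(2,3)])
  using assms(1,4) smap_mem[OF assms(2)] smap_mem[OF assms(3)]
  unfolding is_mono_def inj_on_def smap_comp_cong by blast

lemma is_mono_iff_cancel:
  fixes X :: "'a sset"
  shows "is_mono X Y f \<longleftrightarrow> is_smap X Y f \<and>
    (\<forall>(T :: ('a \<times> 'a) sset) u v. is_smap T X u \<and> is_smap T X v \<and> smap_comp T f u = smap_comp T f v \<longrightarrow> u = v)"
proof
  assume "is_mono X Y f" then show "is_smap X Y f \<and>
    (\<forall>(T :: ('a \<times> 'a) sset) u v. is_smap T X u \<and> is_smap T X v \<and> smap_comp T f u = smap_comp T f v \<longrightarrow> u = v)"
    using is_mono_cancel[of X Y f] by (auto simp: is_mono_def)
next
  assume R: "is_smap X Y f \<and>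
    (\<forall>(T :: ('a \<times> 'a) sset) u v. is_smap T X u \<and> is_smap T X v \<and> smap_comp T f u = smap_comp T f v \<longrightarrow> u = v)"
  let ?P = "fibre_product X X f f"
  have S: "simplices ?P n = {(a, e). a \<in> simplices X n \<and> e \<in> simplices X n \<and> f n a = f n e}" for n
    by (simp add: fibre_product_def)
  have P: "is_smap ?P X (proj1 ?P)" "is_smap ?P X (proj2 ?P)" using is_smap_proj R by blast+
  have "smap_comp ?P f (proj1 ?P) = smap_comp ?P f (proj2 ?P)"
    by (auto simp: smap_comp_cong S proj1_def proj2_def)
  with R P have eq: "proj1 ?P = proj2 ?P" by blast
  show "is_mono X Y f" unfolding is_mono_def
  proof (intro conjI allI inj_onI)
    show "is_smap X Y f" using R by simp
    fix n x y assume a: "x \<in> simplices X n" "y \<in> simplices X n" "f n x = f n y"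
    then show "x = y" using fun_cong[OF fun_cong[OF eq], of n "(x,y)"] by (auto simp: S proj1_def proj2_def)
  qed
qed

lemma Cmp_eq: "Cmp Delta x \<alpha> = (fst \<alpha>, fst (snd x), compose {..fst \<alpha>} (snd (snd x)) (snd (snd \<alpha>)))"
  by (cases x; cases \<alpha>) simp

lemma is_sset_horn: "is_sset (horn n k)"
  unfolding horn_def sub_sset_def
proof (rule is_sset_mk, unfold mem_Collect_eq, goal_cases)
  case (1 \<alpha> x)
  then have x: "x \<in> simplices (simplex n) (Cod Delta \<alpha>)" by simp
  have m: "act (simplex n) \<alpha> x \<in> simplices (simplex n) (Dom Delta \<alpha>)" by (rule act_mem[OF is_sset_simplex 1(1) x])
  have e: "act (simplex n) \<alpha> x = Cmp Delta x \<alpha>" using 1(1) x by (simp add: simplex_def)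
  obtain m' l f where al: "\<alpha> = (m', l, f)" "f \<in> {..m'} \<rightarrow>\<^sub>E {..l}" using 1(1) by (auto simp: Delta_Ar)
  obtain a b g where xx: "x = (a, b, g)" by (cases x)
  from 1(2) obtain i where i: "i \<le> n" "i \<noteq> k" "i \<notin> g ` {..l}" unfolding xx al by auto
  have "i \<notin> compose {..m'} g f ` {..m'}" using i(3) al(2) by (auto simp: compose_def)
  then show ?case using m i(1,2) unfolding e by (auto simp: Cmp_eq al xx)
next
  case (2 n x) then show ?case using act_Idn[OF is_sset_simplex] by blast
next
  case (3 \<alpha> \<beta> x) then show ?case using act_Cmp[OF is_sset_simplex 3(1-3)] by blast
qed

lemma V_proj_mem: "F \<in> simplices (V_tilde S) n \<Longrightarrow> V_proj S n F \<in> simplices (V_base S) n"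
proof -
  assume F: "F \<in> simplices (V_tilde S) n"
  have fo: "is_functor (pset_cat S) (set_cat S) (forget S)"
    unfolding is_functor_def forget_def pset_cat_def set_cat_def concrete_cat_def
    by (auto simp: compose_def Pi_def PiE_def)
  show ?thesis using F unfolding V_proj_def 
    apply (simp add: hs_def)
    apply (rule is_functor_comp[OF _ _ _ _ fo])
    using slice_closed slice_DC slice_Idn by (auto simp: op_cat_def)
qed

lemma fun_comp_assoc:
  assumes "\<And>x. x \<in> Ob C \<Longrightarrow> on_ob G x \<in> Ob C'" "\<And>x. x \<in> Ar C \<Longrightarrow> on_ar G x \<in> Ar C'"
  shows "fun_comp C H (fun_comp C F G) = fun_comp C (fun_comp C' H F) G"
  using assms by (auto simp: fun_comp_def fun_eq_iff restrict_def)

lemma V_proj_smap: "is_smap (V_tilde S) (V_base S) (V_proj S)"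
  unfolding is_smap_def
proof (intro conjI allI ballI is_sset_hs)
  show "V_proj S n \<in> simplices (V_tilde S) n \<rightarrow>\<^sub>E simplices (V_base S) n" for n
  proof
    show "V_proj S n F \<in> simplices (V_base S) n" if "F \<in> simplices (V_tilde S) n" for F using V_proj_mem[OF that] .
    show "V_proj S n F = undefined" if "F \<notin> simplices (V_tilde S) n" for F using that by (simp add: V_proj_def)
  qed
  fix \<alpha> F assume a: "\<alpha> \<in> Ar Delta" "F \<in> simplices (V_tilde S) (Cod Delta \<alpha>)"
  have b: "act (V_tilde S) \<alpha> F \<in> simplices (V_tilde S) (Dom Delta \<alpha>)"
     using act_mem[OF is_sset_hs a] .
  have c: "V_proj S (Cod Delta \<alpha>) F \<in> simplices (V_base S) (Cod Delta \<alpha>)" using V_proj_mem[OF a(2)] .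
  have sc: "x \<in> Ob (slice_cat Delta (Dom Delta \<alpha>)) \<Longrightarrow> on_ob (slice_comp Delta \<alpha>) x \<in> Ob (slice_cat Delta (Cod Delta \<alpha>))"
     "y \<in> Ar (slice_cat Delta (Dom Delta \<alpha>)) \<Longrightarrow> on_ar (slice_comp Delta \<alpha>) y \<in> Ar (slice_cat Delta (Cod Delta \<alpha>))" for x y
    using slice_comp_functor[OF a(1)] unfolding is_functor_def by blast+
  have e: "V_proj S n F = fun_comp (op_cat (slice_cat Delta n)) (forget S) F" if "F \<in> simplices (V_tilde S) n" for n F
    using that by (simp add: V_proj_def)
  have f: "act (hs D) \<alpha> F = fun_comp (op_cat (slice_cat Delta (Dom Delta \<alpha>))) F (slice_comp Delta \<alpha>)"
    if "F \<in> simplices (hs D) (Cod Delta \<alpha>)" for F and D :: "('p,'q) cat"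
    using that a(1) by (simp add: hs_def)
  show "V_proj S (Dom Delta \<alpha>) (act (V_tilde S) \<alpha> F) = act (V_base S) \<alpha> (V_proj S (Cod Delta \<alpha>) F)"
    unfolding e[OF b] f[OF c]
 unfolding f[OF a(2)] e[OF a(2)]
    by (rule fun_comp_assoc) (use sc in \<open>simp_all add: op_cat_def del: split_paired_All split_paired_Ex\<close>)
qed

end

(* A lift of a presheaf on the slice over [n] to pointed sets is the same as an element of its value
   at the terminal object, so the fibre of the universe over A is A(id).  Hence pulling the universe
   back along k : B -> V amounts to giving sets T(b) in S, functorially in the simplices b of B, and
   k can be recovered from them by k(b)(f) = T(b f).

   For realignment choose bijections from the fibres of p to members of S: those transported from
   the given square over the image of i, and arbitrary ones elsewhere, which exist by smallness.
   Since i is a monomorphism the choice is consistent, and transporting the action of E along the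
   bijections gives k, which then extends h strictly.

   Horn lifting problems live over simplices, so the map classified by k is a Kan fibration if and
   only if k lands in U. *)

theory Submission
  imports Defs
begin

section \<open>Presheaves on slices of the simplex category\<close>

text \<open>The equations asked of \<open>k\<close> and \<open>l\<close> are strict, whereas the
  fibres of \<open>p\<close> are sets of an unrelated type, known only up to bijection. Strictness
  is affordable because sets and bijections are chosen one simplex at a time. A simplex outside the
  image of \<open>i\<close> may well have faces inside it, but no compatibility between the choice
  at a simplex and the choices at its faces is demanded: all functoriality is that of
  \<open>E\<close>, carried along the bijections. Indexing by a whole slice is what makes
  \<open>k\<close> natural on the nose, because its value at f depends on the restricted simplex
  alone. Agreement with \<open>h\<close> over the image of \<open>i\<close> then has two halves: the
  values agree by the choice of the sets, and the restriction maps agree because the bijections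
  there are induced by \<open>g\<close>, which is itself simplicial.\<close>

declare split_paired_All [simp del] split_paired_Ex [simp del]

text \<open>Identities stay folded from here on: rewritten to triples by
  \<open>Delta_simps(3)\<close>, they would no longer match the unit laws
  \<open>Delta_id\<close>.\<close>

lemma Delta_Idn_simps [simp]: "Dom Delta (Idn Delta n) = n" "Cod Delta (Idn Delta n) = n"
  by simp_all

declare Delta_simps(3) [simp del]

section \<open>Computation rules for slices, sets and pointed sets\<close>

lemma slice_Ob: "Ob (slice_cat Delta n) = {f \<in> Ar Delta. Cod Delta f = n}"
  by (simp add: slice_cat_def)

lemma slice_Ar_iff:
  "a \<in> Ar (slice_cat Delta n) \<longleftrightarrow>
    (\<exists>g u. a = (Cmp Delta g u, g, u) \<and> g \<in> Ar Delta \<and> Cod Delta g = n \<and> u \<in> Ar Delta \<and>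
       Cod Delta u = Dom Delta g)"
  using Delta_Cmp by (cases a) (fastforce simp: slice_cat_def)

lemma slice_simps [simp]:
  "Dom (slice_cat Delta n) (f, g, u) = f" "Cod (slice_cat Delta n) (f, g, u) = g"
  "Idn (slice_cat Delta n) f = (f, f, Idn Delta (Dom Delta f))"
  "Cmp (slice_cat Delta n) (g', h, v) (f, g, u) = (f, h, Cmp Delta v u)"
  by (simp_all add: slice_cat_def)

lemma op_cat_simps [simp]:
  "Ob (op_cat C) = Ob C" "Ar (op_cat C) = Ar C" "Dom (op_cat C) = Cod C" "Cod (op_cat C) = Dom C"
  "Idn (op_cat C) = Idn C" "Cmp (op_cat C) g f = Cmp C f g"
  by (simp_all add: op_cat_def)

lemma set_cat_simps [simp]:
  "Ob (set_cat S) = S"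
  "(X, Y, f) \<in> Ar (set_cat S) \<longleftrightarrow> X \<in> S \<and> Y \<in> S \<and> f \<in> X \<rightarrow>\<^sub>E Y"
  "Dom (set_cat S) (X, Y, f) = X" "Cod (set_cat S) (X, Y, f) = Y"
  "Idn (set_cat S) X = (X, X, \<lambda>x\<in>X. x)"
  "Cmp (set_cat S) (Y', Z, g) (X, Y, f) = (X, Z, compose X g f)"
  by (simp_all add: set_cat_def concrete_cat_def)

lemma pset_cat_simps [simp]:
  "(X, x) \<in> Ob (pset_cat S) \<longleftrightarrow> X \<in> S \<and> x \<in> X"
  "((X, x), (Y, y), f) \<in> Ar (pset_cat S) \<longleftrightarrow> X \<in> S \<and> x \<in> X \<and> Y \<in> S \<and> y \<in> Y \<and> f \<in> X \<rightarrow>\<^sub>E Y \<and> f x = y"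
  "Dom (pset_cat S) (P, Q, f) = P" "Cod (pset_cat S) (P, Q, f) = Q"
  "Idn (pset_cat S) P = (P, P, \<lambda>x\<in>fst P. x)"
  "Cmp (pset_cat S) (Q', R, g) (P, Q, f) = (P, R, compose (fst P) g f)"
  by (auto simp: pset_cat_def concrete_cat_def)

lemma Delta_id_right': "f \<in> Ar Delta \<Longrightarrow> Dom Delta f = n \<Longrightarrow> Cmp Delta f (Idn Delta n) = f"
  using Delta_id_right by blast

lemma Delta_id_left': "f \<in> Ar Delta \<Longrightarrow> Cod Delta f = n \<Longrightarrow> Cmp Delta (Idn Delta n) f = f"
  using Delta_id_left by blast

lemmas Delta_id = Delta_id_left' Delta_id_right'

section \<open>Simplices of the universe in coordinates\<close>

lemma simplices_hs: "simplices (hs C) n = {F. is_functor (op_cat (slice_cat Delta n)) C F}"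
  by (simp add: hs_def)

text \<open>Composition with \<alpha> moves the codomain \<open>g\<close> of a slice arrow and keeps
  the underlying operator \<open>u\<close>. Associativity brings the domain back to the normal form
  (\<alpha> g) u.\<close>

lemma act_hs:
  assumes "\<alpha> \<in> Ar Delta" "F \<in> simplices (hs C) (Cod Delta \<alpha>)"
  shows "\<And>f. f \<in> Ar Delta \<Longrightarrow> Cod Delta f = Dom Delta \<alpha> \<Longrightarrow> on_ob (act (hs C) \<alpha> F) f = on_ob F (Cmp Delta \<alpha> f)"
    and "\<And>g u. g \<in> Ar Delta \<Longrightarrow> Cod Delta g = Dom Delta \<alpha> \<Longrightarrow> u \<in> Ar Delta \<Longrightarrow> Cod Delta u = Dom Delta g \<Longrightarrow>
      on_ar (act (hs C) \<alpha> F) (Cmp Delta g u, g, u) =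
      on_ar F (Cmp Delta (Cmp Delta \<alpha> g) u, Cmp Delta \<alpha> g, u)"
proof -
  have e: "act (hs C) \<alpha> F = fun_comp (op_cat (slice_cat Delta (Dom Delta \<alpha>))) F (slice_comp Delta \<alpha>)"
    using assms by (simp add: hs_def)
  fix f assume f: "f \<in> Ar Delta" "Cod Delta f = Dom Delta \<alpha>"
  show "on_ob (act (hs C) \<alpha> F) f = on_ob F (Cmp Delta \<alpha> f)"
    using f by (simp add: e fun_comp_def slice_comp_def slice_Ob)
next
  have e: "act (hs C) \<alpha> F = fun_comp (op_cat (slice_cat Delta (Dom Delta \<alpha>))) F (slice_comp Delta \<alpha>)"
    using assms by (simp add: hs_def)
  fix g u assume gu: "g \<in> Ar Delta" "Cod Delta g = Dom Delta \<alpha>" "u \<in> Ar Delta" "Cod Delta u = Dom Delta g"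
  then have "(Cmp Delta g u, g, u) \<in> Ar (slice_cat Delta (Dom Delta \<alpha>))"
    unfolding slice_Ar_iff by blast
  then show "on_ar (act (hs C) \<alpha> F) (Cmp Delta g u, g, u) =
      on_ar F (Cmp Delta (Cmp Delta \<alpha> g) u, Cmp Delta \<alpha> g, u)"
    using gu assms(1) Delta_assoc[of u g \<alpha>] by (simp add: e fun_comp_def slice_comp_def)
qed

text \<open>An arrow of the slice over \<open>[n]\<close> is determined by its codomain \<^term>\<open>g\<close> and its underlying
  operator \<^term>\<open>u\<close>; on presheaves it acts by restriction along \<^term>\<open>u\<close>.\<close>

definition res :: "('u set, 'u set_arrow) hs_elt \<Rightarrow> delta_arrow \<Rightarrow> delta_arrow \<Rightarrow> 'u \<Rightarrow> 'u" where
  "res A g u = snd (snd (on_ar A (Cmp Delta g u, g, u)))"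

text \<open>The restrictions to carriers keep functor and maps extensional, as membership in
  \<open>V_base\<close> requires and as equality of simplices presupposes.\<close>

definition mk_psh ::
  "nat \<Rightarrow> (delta_arrow \<Rightarrow> 'u set) \<Rightarrow> (delta_arrow \<Rightarrow> delta_arrow \<Rightarrow> 'u \<Rightarrow> 'u) \<Rightarrow> ('u set, 'u set_arrow) hs_elt"
where
  "mk_psh n X r = \<lparr>on_ob = restrict X (Ob (slice_cat Delta n)),
     on_ar = (\<lambda>(f, g, u)\<in>Ar (slice_cat Delta n). (X g, X f, restrict (r g u) (X g)))\<rparr>"

text \<open>The functor laws in the coordinates (g, u). In the composition law the second
  restriction starts at \<open>Cmp Delta g u\<close>, since restricting along \<open>u\<close> has
  moved from \<open>g\<close> to that object.\<close>

lemma V_D: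
  assumes "A \<in> simplices (V_base S) n"
  shows "\<And>g. g \<in> Ar Delta \<Longrightarrow> Cod Delta g = n \<Longrightarrow> on_ob A g \<in> S"
    and "\<And>g u. g \<in> Ar Delta \<Longrightarrow> Cod Delta g = n \<Longrightarrow> u \<in> Ar Delta \<Longrightarrow> Cod Delta u = Dom Delta g \<Longrightarrow>
      on_ar A (Cmp Delta g u, g, u) = (on_ob A g, on_ob A (Cmp Delta g u), res A g u)"
    and "\<And>g u. g \<in> Ar Delta \<Longrightarrow> Cod Delta g = n \<Longrightarrow> u \<in> Ar Delta \<Longrightarrow> Cod Delta u = Dom Delta g \<Longrightarrow>
      res A g u \<in> on_ob A g \<rightarrow>\<^sub>E on_ob A (Cmp Delta g u)"
    and "\<And>g. g \<in> Ar Delta \<Longrightarrow> Cod Delta g = n \<Longrightarrow> res A g (Idn Delta (Dom Delta g)) = (\<lambda>x\<in>on_ob A g. x)"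
    and "\<And>g u v. g \<in> Ar Delta \<Longrightarrow> Cod Delta g = n \<Longrightarrow> u \<in> Ar Delta \<Longrightarrow> Cod Delta u = Dom Delta g \<Longrightarrow>
      v \<in> Ar Delta \<Longrightarrow> Cod Delta v = Dom Delta u \<Longrightarrow>
      res A g (Cmp Delta u v) = compose (on_ob A g) (res A (Cmp Delta g u) v) (res A g u)"
    and "on_ob A \<in> extensional (Ob (slice_cat Delta n))" "on_ar A \<in> extensional (Ar (slice_cat Delta n))"
proof -
  let ?C = "slice_cat Delta n"
  have F: "is_functor (op_cat ?C) (set_cat S) A" using assms by (simp add: simplices_hs)
  note F' = F[unfolded is_functor_def op_cat_simps]
  show "on_ob A \<in> extensional (Ob ?C)" "on_ar A \<in> extensional (Ar ?C)" using F' by (auto simp: PiE_def)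
  show ob: "on_ob A g \<in> S" if "g \<in> Ar Delta" "Cod Delta g = n" for g
    using F' that by (auto simp: slice_Ob PiE_def Pi_def)
  have a: "on_ar A (Cmp Delta g u, g, u) = (on_ob A g, on_ob A (Cmp Delta g u), res A g u) \<and>
      res A g u \<in> on_ob A g \<rightarrow>\<^sub>E on_ob A (Cmp Delta g u)"
    if "g \<in> Ar Delta" "Cod Delta g = n" "u \<in> Ar Delta" "Cod Delta u = Dom Delta g" for g u
  proof -
    have m: "(Cmp Delta g u, g, u) \<in> Ar ?C" using that unfolding slice_Ar_iff by blast
    have "on_ar A (Cmp Delta g u, g, u) \<in> Ar (set_cat S)"
      "Dom (set_cat S) (on_ar A (Cmp Delta g u, g, u)) = on_ob A g"
      "Cod (set_cat S) (on_ar A (Cmp Delta g u, g, u)) = on_ob A (Cmp Delta g u)"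
      using F' m by (auto simp: PiE_def Pi_def)
    then show ?thesis unfolding res_def by (cases "on_ar A (Cmp Delta g u, g, u)") auto
  qed
  show ar: "on_ar A (Cmp Delta g u, g, u) = (on_ob A g, on_ob A (Cmp Delta g u), res A g u)"
    "res A g u \<in> on_ob A g \<rightarrow>\<^sub>E on_ob A (Cmp Delta g u)"
    if "g \<in> Ar Delta" "Cod Delta g = n" "u \<in> Ar Delta" "Cod Delta u = Dom Delta g" for g u
    using a[OF that] by auto
  show "res A g (Idn Delta (Dom Delta g)) = (\<lambda>x\<in>on_ob A g. x)" if g: "g \<in> Ar Delta" "Cod Delta g = n" for g
  proof -
    have "on_ar A (g, g, Idn Delta (Dom Delta g)) = (on_ob A g, on_ob A g, \<lambda>x\<in>on_ob A g. x)"
      using F' g by (simp add: slice_Ob)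
    then show ?thesis using g by (simp add: res_def Delta_id)
  qed
  show "res A g (Cmp Delta u v) = compose (on_ob A g) (res A (Cmp Delta g u) v) (res A g u)"
    if g: "g \<in> Ar Delta" "Cod Delta g = n" and u: "u \<in> Ar Delta" "Cod Delta u = Dom Delta g"
      and v: "v \<in> Ar Delta" "Cod Delta v = Dom Delta u" for g u v
  proof -
    note c = Delta_Cmp[OF u(1) g(1) u(2)]
    have m: "(Cmp Delta g u, g, u) \<in> Ar ?C" "(Cmp Delta (Cmp Delta g u) v, Cmp Delta g u, v) \<in> Ar ?C"
      using g u v c unfolding slice_Ar_iff by metis+
    have "on_ar A (Cmp Delta (Cmp Delta g u) v, g, Cmp Delta u v) =
      Cmp (set_cat S) (on_ar A (Cmp Delta (Cmp Delta g u) v, Cmp Delta g u, v)) (on_ar A (Cmp Delta g u, g, u))"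
      using F' m by fastforce
    moreover have "res A g (Cmp Delta u v) = snd (snd (on_ar A (Cmp Delta (Cmp Delta g u) v, g, Cmp Delta u v)))"
      using g u v Delta_assoc[of v u g] by (simp add: res_def)
    ultimately show ?thesis using g u v c a[OF g u] a[of "Cmp Delta g u" v] by simp
  qed
qed

text \<open>Simplices of V are compared by equality, not isomorphism. As functors and arrows are
  extensional, this comes down to equal values and equal restrictions of elements.\<close>

lemma V_eqI:
  assumes A: "A \<in> simplices (V_base S) n" and B: "B \<in> simplices (V_base S) n"
    and ob: "\<And>g. g \<in> Ar Delta \<Longrightarrow> Cod Delta g = n \<Longrightarrow> on_ob A g = on_ob B g"
    and ar: "\<And>g u x. g \<in> Ar Delta \<Longrightarrow> Cod Delta g = n \<Longrightarrow> u \<in> Ar Delta \<Longrightarrow> Cod Delta u = Dom Delta g \<Longrightarrow>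
      x \<in> on_ob A g \<Longrightarrow> res A g u x = res B g u x"
  shows "A = B"
proof -
  have 1: "on_ob A = on_ob B"
    using V_D(6)[OF A] V_D(6)[OF B] ob by (auto intro!: extensionalityI simp: slice_Ob)
  have 2: "on_ar A = on_ar B"
  proof (rule extensionalityI[OF V_D(7)[OF A] V_D(7)[OF B]])
    fix a assume "a \<in> Ar (slice_cat Delta n)"
    then obtain g u where a: "a = (Cmp Delta g u, g, u)"
      and gu: "g \<in> Ar Delta" "Cod Delta g = n" "u \<in> Ar Delta" "Cod Delta u = Dom Delta g"
      unfolding slice_Ar_iff by blast
    have "res A g u = res B g u"
      using V_D(3)[OF A gu] V_D(3)[OF B gu] ar[OF gu] by (simp add: 1 PiE_eq_iff) (metis 1 PiE_ext)
    then show "on_ar A a = on_ar B a" using V_D(2)[OF A gu] V_D(2)[OF B gu] a by (simp add: 1)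
  qed
  show ?thesis using 1 2 by simp
qed

lemma mk_psh_simps:
  "g \<in> Ar Delta \<Longrightarrow> Cod Delta g = n \<Longrightarrow> on_ob (mk_psh n X r) g = X g"
  "g \<in> Ar Delta \<Longrightarrow> Cod Delta g = n \<Longrightarrow> u \<in> Ar Delta \<Longrightarrow> Cod Delta u = Dom Delta g \<Longrightarrow> x \<in> X g \<Longrightarrow>
    res (mk_psh n X r) g u x = r g u x"
proof -
  show "on_ob (mk_psh n X r) g = X g" if "g \<in> Ar Delta" "Cod Delta g = n"
    using that by (simp add: mk_psh_def slice_Ob)
  assume a: "g \<in> Ar Delta" "Cod Delta g = n" "u \<in> Ar Delta" "Cod Delta u = Dom Delta g" "x \<in> X g"
  then have "(Cmp Delta g u, g, u) \<in> Ar (slice_cat Delta n)" unfolding slice_Ar_iff by blast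
  then show "res (mk_psh n X r) g u x = r g u x"
    using a by (simp add: mk_psh_def res_def)
qed

lemma mk_psh_in_V:
  assumes X: "\<And>g. g \<in> Ar Delta \<Longrightarrow> Cod Delta g = n \<Longrightarrow> X g \<in> S"
    and r: "\<And>g u x. g \<in> Ar Delta \<Longrightarrow> Cod Delta g = n \<Longrightarrow> u \<in> Ar Delta \<Longrightarrow> Cod Delta u = Dom Delta g \<Longrightarrow>
      x \<in> X g \<Longrightarrow> r g u x \<in> X (Cmp Delta g u)"
    and r_id: "\<And>g x. g \<in> Ar Delta \<Longrightarrow> Cod Delta g = n \<Longrightarrow> x \<in> X g \<Longrightarrow> r g (Idn Delta (Dom Delta g)) x = x"
    and r_Cmp: "\<And>g u v x. g \<in> Ar Delta \<Longrightarrow> Cod Delta g = n \<Longrightarrow> u \<in> Ar Delta \<Longrightarrow> Cod Delta u = Dom Delta g \<Longrightarrow>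
      v \<in> Ar Delta \<Longrightarrow> Cod Delta v = Dom Delta u \<Longrightarrow> x \<in> X g \<Longrightarrow>
      r g (Cmp Delta u v) x = r (Cmp Delta g u) v (r g u x)"
  shows "mk_psh n X r \<in> simplices (V_base S) n"
proof -
  let ?C = "slice_cat Delta n" and ?F = "mk_psh n X r"
  have ob: "on_ob ?F g = X g" if "g \<in> Ob ?C" for g using that by (simp add: mk_psh_def)
  have ar: "on_ar ?F (f, g, u) = (X g, X f, restrict (r g u) (X g))" if "(f, g, u) \<in> Ar ?C" for f g u
    using that by (simp add: mk_psh_def)
  have "is_functor (op_cat ?C) (set_cat S) ?F"
    unfolding is_functor_def op_cat_simps
  proof (intro conjI ballI impI)
    show "on_ob ?F \<in> Ob ?C \<rightarrow>\<^sub>E Ob (set_cat S)" using X by (auto simp: mk_psh_def slice_Ob)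
    show "on_ar ?F \<in> Ar ?C \<rightarrow>\<^sub>E Ar (set_cat S)"
    proof
      fix a assume m: "a \<in> Ar ?C"
      then obtain g u where a: "a = (Cmp Delta g u, g, u)"
        and gu: "g \<in> Ar Delta" "Cod Delta g = n" "u \<in> Ar Delta" "Cod Delta u = Dom Delta g"
        unfolding slice_Ar_iff by blast
      show "on_ar ?F a \<in> Ar (set_cat S)"
        using X[of g] X[of "Cmp Delta g u"] r[OF gu] gu Delta_Cmp[OF gu(3,1,4)] m
        unfolding a by (simp add: ar)
    qed (simp add: mk_psh_def)
  next
    fix a assume m: "a \<in> Ar ?C"
    then have o: "Dom ?C a \<in> Ob ?C" "Cod ?C a \<in> Ob ?C" using slice_DC by blast+
    show "Dom (set_cat S) (on_ar ?F a) = on_ob ?F (Cod ?C a)" "Cod (set_cat S) (on_ar ?F a) = on_ob ?F (Dom ?C a)"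
      using m o by (cases a; simp add: ar ob)+
  next
    fix g assume g: "g \<in> Ob ?C"
    show "on_ar ?F (Idn ?C g) = Idn (set_cat S) (on_ob ?F g)"
      using slice_Idn[OF g] g r_id[of g] by (auto simp: ar ob slice_Ob)
  next
    fix a b assume ab: "a \<in> Ar ?C" "b \<in> Ar ?C" "Dom ?C a = Cod ?C b"
    obtain g u where a: "a = (Cmp Delta g u, g, u)"
      and gu: "g \<in> Ar Delta" "Cod Delta g = n" "u \<in> Ar Delta" "Cod Delta u = Dom Delta g"
      using ab(1) unfolding slice_Ar_iff by blast
    obtain v where b: "b = (Cmp Delta (Cmp Delta g u) v, Cmp Delta g u, v)"
      and v: "v \<in> Ar Delta" "Cod Delta v = Dom Delta u"
      using ab(2,3) Delta_Cmp[OF gu(3,1,4)] unfolding slice_Ar_iff a by auto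
    have c: "(Cmp Delta (Cmp Delta g u) v, g, Cmp Delta u v) \<in> Ar ?C"
      using slice_closed[OF ab(2,1) ab(3)[symmetric]] unfolding a b by simp
    show "on_ar ?F (Cmp ?C a b) = Cmp (set_cat S) (on_ar ?F b) (on_ar ?F a)"
      using ab c r_Cmp[OF gu v] r[OF gu] unfolding a b
      by (simp add: ar compose_def fun_eq_iff restrict_def)
  qed
  then show ?thesis by (simp add: simplices_hs)
qed

lemma act_V:
  assumes "\<alpha> \<in> Ar Delta" "A \<in> simplices (V_base S) (Cod Delta \<alpha>)"
  shows "g \<in> Ar Delta \<Longrightarrow> Cod Delta g = Dom Delta \<alpha> \<Longrightarrow> u \<in> Ar Delta \<Longrightarrow> Cod Delta u = Dom Delta g \<Longrightarrow>
      res (act (V_base S) \<alpha> A) g u = res A (Cmp Delta \<alpha> g) u"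
  using act_hs(2)[OF assms] by (simp add: res_def)

text \<open>A functor to pointed sets is determined by the functor to sets it lifts and by its value at the
  terminal object of the slice, and that value is an arbitrary element.\<close>

definition pt :: "nat \<Rightarrow> ('u set \<times> 'u, 'u pset_arrow) hs_elt \<Rightarrow> 'u" where
  "pt n F = snd (on_ob F (Idn Delta n))"

text \<open>The base point at \<open>g\<close> is \<open>x\<close> restricted along the unique arrow
  from \<open>g\<close> to the terminal object \<open>Idn Delta n\<close>.\<close>

definition lift :: "nat \<Rightarrow> ('u set, 'u set_arrow) hs_elt \<Rightarrow> 'u \<Rightarrow> ('u set \<times> 'u, 'u pset_arrow) hs_elt" where
  "lift n A x = (let X = (\<lambda>g. (on_ob A g, res A (Idn Delta n) g x)) in
     \<lparr>on_ob = restrict X (Ob (slice_cat Delta n)),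
      on_ar = (\<lambda>(f, g, u)\<in>Ar (slice_cat Delta n). (X g, X f, res A g u))\<rparr>)"

text \<open>Pointed maps leave no freedom: the arrow from \<open>g\<close> to the terminal object
  must carry base point to base point, so every base point is a restriction of
  \<open>pt n F\<close>.\<close>

lemma V_tilde_D:
  assumes F: "F \<in> simplices (V_tilde S) n"
  defines "A \<equiv> V_proj S n F"
  shows "\<And>g. g \<in> Ar Delta \<Longrightarrow> Cod Delta g = n \<Longrightarrow> on_ob F g = (on_ob A g, res A (Idn Delta n) g (pt n F))"
    and "\<And>g u. g \<in> Ar Delta \<Longrightarrow> Cod Delta g = n \<Longrightarrow> u \<in> Ar Delta \<Longrightarrow> Cod Delta u = Dom Delta g \<Longrightarrow>
      on_ar F (Cmp Delta g u, g, u) = (on_ob F g, on_ob F (Cmp Delta g u), res A g u)"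
    and "pt n F \<in> on_ob A (Idn Delta n)"
    and "on_ob F \<in> extensional (Ob (slice_cat Delta n))" "on_ar F \<in> extensional (Ar (slice_cat Delta n))"
proof -
  let ?C = "slice_cat Delta n"
  have "is_functor (op_cat ?C) (pset_cat S) F" using F by (simp add: simplices_hs)
  note F' = this[unfolded is_functor_def op_cat_simps]
  show "on_ob F \<in> extensional (Ob ?C)" "on_ar F \<in> extensional (Ar ?C)" using F' by (auto simp: PiE_def)
  have A: "A = fun_comp (op_cat ?C) (forget S) F" using F by (simp add: A_def V_proj_def)
  have ob: "on_ob A g = fst (on_ob F g) \<and> snd (on_ob F g) \<in> on_ob A g" if "g \<in> Ar Delta" "Cod Delta g = n" for g
  proof -
    have "on_ob F g \<in> Ob (pset_cat S)" using F' that by (auto simp: slice_Ob PiE_def Pi_def)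
    then show ?thesis using that by (cases "on_ob F g") (simp add: A fun_comp_def slice_Ob forget_def)
  qed
  have ar: "on_ar F (Cmp Delta g u, g, u) = (on_ob F g, on_ob F (Cmp Delta g u), res A g u) \<and>
     res A g u (snd (on_ob F g)) = snd (on_ob F (Cmp Delta g u))"
    if "g \<in> Ar Delta" "Cod Delta g = n" "u \<in> Ar Delta" "Cod Delta u = Dom Delta g" for g u
  proof -
    let ?a = "(Cmp Delta g u, g, u)"
    have m: "?a \<in> Ar ?C" using that unfolding slice_Ar_iff by blast
    have a: "on_ar F ?a \<in> Ar (pset_cat S)"
      "on_ob F g = Dom (pset_cat S) (on_ar F ?a)" "on_ob F (Cmp Delta g u) = Cod (pset_cat S) (on_ar F ?a)"
      using F' m by (auto simp: PiE_def Pi_def)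
    obtain X x Y y f where e: "on_ar F ?a = ((X, x), (Y, y), f)" by (metis surj_pair)
    show ?thesis using m a(1) by (simp add: A a(2,3) e res_def fun_comp_def forget_def)
  qed
  show "on_ar F (Cmp Delta g u, g, u) = (on_ob F g, on_ob F (Cmp Delta g u), res A g u)"
    if "g \<in> Ar Delta" "Cod Delta g = n" "u \<in> Ar Delta" "Cod Delta u = Dom Delta g" for g u
    using ar[OF that] by simp
  show "on_ob F g = (on_ob A g, res A (Idn Delta n) g (pt n F))" if "g \<in> Ar Delta" "Cod Delta g = n" for g
    using ar[of "Idn Delta n" g] ob[OF that] that
    by (simp add: Delta_Idn Delta_id pt_def prod_eq_iff)
  show "pt n F \<in> on_ob A (Idn Delta n)" using ob[of "Idn Delta n", THEN conjunct2] by (simp add: Delta_Idn pt_def)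
qed

lemma V_tilde_eqI:
  assumes F: "F \<in> simplices (V_tilde S) n" and G: "G \<in> simplices (V_tilde S) n"
    and pr: "V_proj S n F = V_proj S n G" and pt: "pt n F = pt n G"
  shows "F = G"
proof -
  have 1: "on_ob F = on_ob G"
    using V_tilde_D(4)[OF F] V_tilde_D(4)[OF G] V_tilde_D(1)[OF F] V_tilde_D(1)[OF G] pr pt
    by (auto intro!: extensionalityI simp: slice_Ob)
  have 2: "on_ar F = on_ar G"
  proof (rule extensionalityI[OF V_tilde_D(5)[OF F] V_tilde_D(5)[OF G]])
    fix a assume "a \<in> Ar (slice_cat Delta n)"
    then show "on_ar F a = on_ar G a"
      unfolding slice_Ar_iff using V_tilde_D(2)[OF F] V_tilde_D(2)[OF G] pr 1 by auto
  qed
  show ?thesis using 1 2 by simp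
qed

lemma lift_in_V_tilde:
  assumes A: "A \<in> simplices (V_base S) n" and x: "x \<in> on_ob A (Idn Delta n)"
  shows "lift n A x \<in> simplices (V_tilde S) n" "V_proj S n (lift n A x) = A" "pt n (lift n A x) = x"
proof -
  let ?C = "slice_cat Delta n" and ?F = "lift n A x" and ?i = "Idn Delta n"
  define X where "X = (\<lambda>g. (on_ob A g, res A ?i g x))"
  have ob: "on_ob ?F g = X g" if "g \<in> Ob ?C" for g using that by (simp add: lift_def X_def Let_def)
  have ar: "on_ar ?F (f, g, u) = (X g, X f, res A g u)" if "(f, g, u) \<in> Ar ?C" for f g u
    using that by (simp add: lift_def X_def Let_def)
  have X: "fst (X g) = on_ob A g" "X g \<in> Ob (pset_cat S)" if "g \<in> Ob ?C" for g
    using that V_D(1)[OF A, of g] V_D(3)[OF A, of ?i g] x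
    by (auto simp: X_def slice_Ob Delta_Idn Delta_id PiE_def Pi_def)
  \<comment> \<open>Restricting along \<open>g\<close> and then along \<open>u\<close> is
    restricting along their composite, so the maps of \<open>A\<close> preserve the proposed base
    points.\<close>
  have rX: "res A g u (snd (X g)) = snd (X (Cmp Delta g u))"
    if "g \<in> Ar Delta" "Cod Delta g = n" "u \<in> Ar Delta" "Cod Delta u = Dom Delta g" for g u
    using V_D(5)[OF A, of ?i g u] that x by (simp add: X_def Delta_Idn Delta_id compose_def)
  have "is_functor (op_cat ?C) (pset_cat S) ?F"
    unfolding is_functor_def op_cat_simps
  proof (intro conjI ballI impI)
    show "on_ob ?F \<in> Ob ?C \<rightarrow>\<^sub>E Ob (pset_cat S)" using X(2) by (auto simp: lift_def Let_def X_def)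
    show "on_ar ?F \<in> Ar ?C \<rightarrow>\<^sub>E Ar (pset_cat S)"
    proof
      fix a assume m: "a \<in> Ar ?C"
      then obtain g u where a: "a = (Cmp Delta g u, g, u)"
        and gu: "g \<in> Ar Delta" "Cod Delta g = n" "u \<in> Ar Delta" "Cod Delta u = Dom Delta g"
        unfolding slice_Ar_iff by blast
      have "g \<in> Ob ?C" "Cmp Delta g u \<in> Ob ?C" using gu Delta_Cmp[OF gu(3,1,4)] by (auto simp: slice_Ob)
      then show "on_ar ?F a \<in> Ar (pset_cat S)"
        using X[of g] X[of "Cmp Delta g u"] rX[OF gu] V_D(3)[OF A gu] m
        unfolding a by (cases "X g"; cases "X (Cmp Delta g u)") (simp add: ar)
    qed (simp add: lift_def Let_def)
  next
    fix a assume m: "a \<in> Ar ?C"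
    then have o: "Dom ?C a \<in> Ob ?C" "Cod ?C a \<in> Ob ?C" using slice_DC by blast+
    show "Dom (pset_cat S) (on_ar ?F a) = on_ob ?F (Cod ?C a)" "Cod (pset_cat S) (on_ar ?F a) = on_ob ?F (Dom ?C a)"
      using m o by (cases a; simp add: ar ob)+
  next
    fix g assume g: "g \<in> Ob ?C"
    show "on_ar ?F (Idn ?C g) = Idn (pset_cat S) (on_ob ?F g)"
      using slice_Idn[OF g] g X(1)[OF g] V_D(4)[OF A, of g] by (simp add: ar ob slice_Ob)
  next
    fix a b assume ab: "a \<in> Ar ?C" "b \<in> Ar ?C" "Dom ?C a = Cod ?C b"
    obtain g u where a: "a = (Cmp Delta g u, g, u)"
      and gu: "g \<in> Ar Delta" "Cod Delta g = n" "u \<in> Ar Delta" "Cod Delta u = Dom Delta g"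
      using ab(1) unfolding slice_Ar_iff by blast
    obtain v where b: "b = (Cmp Delta (Cmp Delta g u) v, Cmp Delta g u, v)"
      and v: "v \<in> Ar Delta" "Cod Delta v = Dom Delta u"
      using ab(2,3) Delta_Cmp[OF gu(3,1,4)] unfolding slice_Ar_iff a by auto
    have c: "(Cmp Delta (Cmp Delta g u) v, g, Cmp Delta u v) \<in> Ar ?C"
      using slice_closed[OF ab(2,1) ab(3)[symmetric]] unfolding a b by simp
    have "g \<in> Ob ?C" using gu by (simp add: slice_Ob)
    then show "on_ar ?F (Cmp ?C a b) = Cmp (pset_cat S) (on_ar ?F b) (on_ar ?F a)"
      using ab c V_D(5)[OF A gu v] X(1)[of g] unfolding a b by (simp add: ar)
  qed
  then show m: "?F \<in> simplices (V_tilde S) n" by (simp add: simplices_hs)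
  have i: "?i \<in> Ob ?C" by (simp add: slice_Ob Delta_Idn)
  show "pt n ?F = x" using V_D(4)[OF A, of ?i] x i by (simp add: pt_def ob X_def slice_Ob)
  have pr: "on_ob (V_proj S n ?F) g = on_ob A g" if "g \<in> Ar Delta" "Cod Delta g = n" for g
    using V_tilde_D(1)[OF m that] that ob[of g] by (simp add: slice_Ob X_def)
  show "V_proj S n ?F = A"
  proof (rule V_eqI[OF V_proj_mem[OF m] A pr])
    fix g u y
    assume gu: "g \<in> Ar Delta" "Cod Delta g = n" "u \<in> Ar Delta" "Cod Delta u = Dom Delta g"
    then have "(Cmp Delta g u, g, u) \<in> Ar ?C" unfolding slice_Ar_iff by blast
    then show "res (V_proj S n ?F) g u y = res A g u y" using V_tilde_D(2)[OF m gu] by (simp add: ar)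
  qed
qed

text \<open>The composition functor sends the identity to \<alpha>, so the new point is the base
  point of \<open>F\<close> at \<alpha>, a restriction of the old one.\<close>

lemma pt_act:
  assumes "\<alpha> \<in> Ar Delta" "F \<in> simplices (V_tilde S) (Cod Delta \<alpha>)"
  shows "pt (Dom Delta \<alpha>) (act (V_tilde S) \<alpha> F) =
    res (V_proj S (Cod Delta \<alpha>) F) (Idn Delta (Cod Delta \<alpha>)) \<alpha> (pt (Cod Delta \<alpha>) F)"
  using act_hs(1)[OF assms, of "Idn Delta (Dom Delta \<alpha>)"] V_tilde_D(1)[OF assms(2,1)] assms
  by (simp add: pt_def Delta_Idn Delta_id)

section \<open>Pullbacks and Kan fibrations\<close>

lemma smap_ssets: "is_smap X Y f \<Longrightarrow> is_sset X" "is_smap X Y f \<Longrightarrow> is_sset Y"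
  by (auto simp: is_smap_def)

lemma is_smapI:
  assumes "is_sset X" "is_sset Y" "\<And>n x. x \<in> simplices X n \<Longrightarrow> f n x \<in> simplices Y n"
    and "\<And>\<alpha> x. \<alpha> \<in> Ar Delta \<Longrightarrow> x \<in> simplices X (Cod Delta \<alpha>) \<Longrightarrow>
      f (Dom Delta \<alpha>) (act X \<alpha> x) = act Y \<alpha> (f (Cod Delta \<alpha>) x)"
  shows "is_smap X Y (\<lambda>n. restrict (f n) (simplices X n))"
  using assms act_mem[OF assms(1)] by (auto simp: is_smap_def)

lemma is_sset_sub_sset:
  assumes X: "is_sset X"
    and P: "\<And>\<alpha> x. \<alpha> \<in> Ar Delta \<Longrightarrow> x \<in> simplices X (Cod Delta \<alpha>) \<Longrightarrow> P (Cod Delta \<alpha>) x \<Longrightarrow>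
      P (Dom Delta \<alpha>) (act X \<alpha> x)"
  shows "is_sset (sub_sset X P)"
  unfolding sub_sset_def
  by (rule is_sset_mk) (use act_mem[OF X] act_Idn[OF X] act_Cmp[OF X] P in auto)

lemma sub_sset_simps [simp]:
  "simplices (sub_sset X P) n = {x \<in> simplices X n. P n x}"
  "\<alpha> \<in> Ar Delta \<Longrightarrow> x \<in> simplices X (Cod Delta \<alpha>) \<Longrightarrow> P (Cod Delta \<alpha>) x \<Longrightarrow> act (sub_sset X P) \<alpha> x = act X \<alpha> x"
  by (simp_all add: sub_sset_def)

lemma incl_sub_sset:
  assumes "is_sset X" "is_sset (sub_sset X P)"
  shows "is_smap (sub_sset X P) X (incl (sub_sset X P))"
  unfolding incl_def by (rule is_smapI[OF assms(2,1)]) auto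

lemma incl_horn: "is_smap (horn n k) (simplex n) (incl (horn n k))"
  using incl_sub_sset[OF is_sset_simplex] is_sset_horn unfolding horn_def by blast

lemma fibre_product_simps [simp]:
  "simplices (fibre_product A E i p) n =
    {(a, e). a \<in> simplices A n \<and> e \<in> simplices E n \<and> i n a = p n e}"
  "\<alpha> \<in> Ar Delta \<Longrightarrow> a \<in> simplices A (Cod Delta \<alpha>) \<Longrightarrow> e \<in> simplices E (Cod Delta \<alpha>) \<Longrightarrow>
    i (Cod Delta \<alpha>) a = p (Cod Delta \<alpha>) e \<Longrightarrow>
    act (fibre_product A E i p) \<alpha> (a, e) = (act A \<alpha> a, act E \<alpha> e)"
  by (simp_all add: fibre_product_def)

lemma is_pullback_fibre_product:
  fixes A :: "'a sset" and E :: "'e sset"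
  assumes i: "is_smap A B i" and p: "is_smap E B p"
  defines "P \<equiv> fibre_product A E i p"
  shows "is_pullback P E A B (proj2 P) (proj1 P) p i"
proof -
  have "bij_betw (\<lambda>d. (proj1 P n d, proj2 P n d)) (simplices P n) (simplices P n)" for n
    by (rule bij_betwI[of _ _ _ id]) (auto simp: proj1_def proj2_def)
  moreover have "smap_comp P i (proj1 P) = smap_comp P p (proj2 P)"
    by (auto simp: smap_comp_cong proj1_def proj2_def P_def)
  ultimately show ?thesis
    using is_smap_proj[OF i p] i p by (simp add: is_pullback_def P_def)
qed

lemma is_pullback_D:
  assumes "is_pullback D E A B j q p i"
  shows "is_smap D E j" "is_smap D A q" "is_smap E B p" "is_smap A B i"
    and "\<And>n d. d \<in> simplices D n \<Longrightarrow> i n (q n d) = p n (j n d)"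
    and "\<And>n. bij_betw (\<lambda>d. (q n d, j n d)) (simplices D n)
      {(a, e). a \<in> simplices A n \<and> e \<in> simplices E n \<and> i n a = p n e}"
  using assms unfolding is_pullback_def smap_comp_cong by simp_all

lemma is_pullback_bij_fibre:
  assumes P: "is_pullback D E A B j q p i" and a: "a \<in> simplices A n"
  shows "bij_betw (j n) {d \<in> simplices D n. q n d = a} {e \<in> simplices E n. p n e = i n a}"
proof -
  note b = is_pullback_D(6)[OF P, of n, unfolded bij_betw_def]
  show ?thesis unfolding bij_betw_def
  proof
    show "inj_on (j n) {d \<in> simplices D n. q n d = a}" using b by (auto simp: inj_on_def)
    have "\<exists>d\<in>simplices D n. q n d = a \<and> j n d = e" if "e \<in> simplices E n" "p n e = i n a" for e
    proof -
      have "(a, e) \<in> (\<lambda>d. (q n d, j n d)) ` simplices D n" using b a that by simp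
      then show ?thesis by auto
    qed
    then show "j n ` {d \<in> simplices D n. q n d = a} = {e \<in> simplices E n. p n e = i n a}"
      using smap_mem[OF is_pullback_D(1)[OF P]] is_pullback_D(5)[OF P] by fastforce
  qed
qed

section \<open>The Yoneda correspondence\<close>

lemma yoneda_smap: "is_sset X \<Longrightarrow> x \<in> simplices X n \<Longrightarrow> is_smap (simplex n) X (yoneda X n x)"
  unfolding yoneda_def
  by (rule is_smapI[OF is_sset_simplex]) (auto simp: simplex_def act_mem act_Cmp)

lemma id_in_simplex: "Idn Delta n \<in> simplices (simplex n) n"
  by (simp add: simplex_def Delta_Idn)

lemma smap_yoneda:
  assumes v: "is_smap (simplex n) X v"
  shows "v = yoneda X n (v n (Idn Delta n))"
proof (rule smap_eqI[OF v yoneda_smap])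
  show "is_sset X" "v n (Idn Delta n) \<in> simplices X n"
    by (rule smap_ssets(2)[OF v], rule smap_mem[OF v id_in_simplex])
  fix m \<alpha> assume a: "\<alpha> \<in> simplices (simplex n) m"
  then have "\<alpha> \<in> Ar Delta" "Dom Delta \<alpha> = m" "Cod Delta \<alpha> = n" by (auto simp: simplex_def)
  moreover have "act (simplex n) \<alpha> (Idn Delta n) = \<alpha>"
    using calculation by (simp add: simplex_def Delta_Idn Delta_id)
  ultimately show "v m \<alpha> = yoneda X n (v n (Idn Delta n)) m \<alpha>"
    using smap_act[OF v, of \<alpha> "Idn Delta n"] id_in_simplex a by (auto simp: yoneda_def)
qed

lemma smap_comp_yoneda:
  assumes "is_smap X Y f" "x \<in> simplices X n"
  shows "smap_comp (simplex n) f (yoneda X n x) = yoneda Y n (f n x)"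
proof -
  note X = smap_ssets(1)[OF assms(1)]
  show ?thesis
    using smap_yoneda[OF smap_comp_smap[OF yoneda_smap[OF X assms(2)] assms(1)]] assms id_in_simplex
    by (simp add: yoneda_def act_Idn[OF X])
qed

text \<open>If \<^term>\<open>s\<close> and \<^term>\<open>p\<close> are both pulled back from \<^term>\<open>\<pi>\<close> and the classifying map of
  \<^term>\<open>s\<close> factors through that of \<^term>\<open>p\<close>, then \<^term>\<open>s\<close> is a pullback of \<^term>\<open>p\<close>.\<close>

lemma kan_fibration_transfer:
  assumes E: "is_pullback E X B Y l p \<pi> k" and P: "is_pullback P X C Y r s \<pi> t"
    and t: "t = smap_comp C k c" and c: "is_smap C B c" and kan: "kan_fibration E B p"
  shows "kan_fibration P C s"
  unfolding kan_fibration_def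
proof (intro conjI allI impI)
  note E' = is_pullback_D[OF E] and P' = is_pullback_D[OF P]
  show "is_smap P C s" by (rule P'(2))
  fix n m u v
  let ?H = "horn n m" and ?i = "incl (horn n m)" and ?S = "simplex n"
  assume a: "1 \<le> n \<and> m \<le> n \<and> is_smap ?H P u \<and> is_smap ?S C v \<and> smap_comp ?H s u = smap_comp ?H v ?i"
  then have u: "is_smap ?H P u" and v: "is_smap ?S C v" by blast+
  have su: "s d (u d z) = v d (?i d z)" if "z \<in> simplices ?H d" for d z
    using a that by (simp add: smap_comp_cong)
  have cv: "is_smap ?S B (smap_comp ?S c v)" and cvi: "is_smap ?H B (smap_comp ?H (smap_comp ?S c v) ?i)"
    by (intro smap_comp_smap[OF v c] smap_comp_smap[OF incl_horn] v)+
  note mem = smap_mem[OF u] smap_mem[OF v] smap_mem[OF incl_horn]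
  have kc: "k d (c d y) = t d y" if "y \<in> simplices C d" for d y using that by (simp add: t)
  \<comment> \<open>The horn moves from \<open>P\<close> to \<open>E\<close> by the universal
    property of \<open>E\<close>; the two components agree over \<open>Y\<close> because
    \<open>t\<close> factors through \<open>k\<close>.\<close>
  obtain x where x: "is_smap ?H E x" "smap_comp ?H l x = smap_comp ?H r u"
    "smap_comp ?H p x = smap_comp ?H (smap_comp ?S c v) ?i"
  proof -
    have "smap_comp ?H k (smap_comp ?H (smap_comp ?S c v) ?i) = smap_comp ?H \<pi> (smap_comp ?H r u)"
      using mem smap_mem[OF P'(2)] by (simp add: smap_comp_cong kc su[symmetric] P'(5))
    then show ?thesis
      using is_pullback_property[OF E, of ?H] smap_comp_smap[OF u P'(1)] cvi that
      unfolding pullback_property_def by blast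
  qed
  obtain w where w: "is_smap ?S E w" "smap_comp ?H w ?i = x" "smap_comp ?S p w = smap_comp ?S c v"
    using kan[unfolded kan_fibration_def] a x cv by blast
  \<comment> \<open>The filler found in \<open>E\<close> returns to \<open>P\<close>, paired with
    the given base map \<open>v\<close>.\<close>
  obtain z where z: "is_smap ?S P z" "smap_comp ?S r z = smap_comp ?S l w" "smap_comp ?S s z = v"
  proof -
    have "p d (w d y) = c d (v d y)" if "y \<in> simplices ?S d" for d y
      using fun_cong[OF fun_cong[OF w(3)], of d y] that by simp
    then have "smap_comp ?S t v = smap_comp ?S \<pi> (smap_comp ?S l w)"
      using mem smap_mem[OF w(1)] by (simp add: smap_comp_cong kc[symmetric] E'(5)[symmetric])
    then show ?thesis
      using is_pullback_property[OF P, of ?S] smap_comp_smap[OF w(1) E'(1)] v that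
      unfolding pullback_property_def by blast
  qed
  have zi: "is_smap ?H P (smap_comp ?H z ?i)" using z(1) incl_horn smap_comp_smap by blast
  have rz: "r d (z d y) = l d (w d y)" "s d (z d y) = v d y" if "y \<in> simplices ?S d" for d y
    using fun_cong[OF fun_cong[OF z(2)], of d y] fun_cong[OF fun_cong[OF z(3)], of d y] that by simp_all
  have wi: "l d (w d (?i d y)) = r d (u d y)" if "y \<in> simplices ?H d" for d y
    using fun_cong[OF fun_cong[OF w(2)], of d y] x(2) that by (simp add: smap_comp_cong)
  \<comment> \<open>That the filler extends \<open>u\<close> follows from uniqueness in the
    universal property of \<open>P\<close>: both maps on the horn have the same composites with
    \<open>r\<close> and \<open>s\<close>.\<close>
  have "smap_comp ?H r (smap_comp ?H z ?i) = smap_comp ?H r u"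
    "smap_comp ?H s (smap_comp ?H z ?i) = smap_comp ?H s u"
    using mem rz wi su by (auto simp: smap_comp_cong)
  moreover have "smap_comp ?H t (smap_comp ?H s u) = smap_comp ?H \<pi> (smap_comp ?H r u)"
    using mem P'(5) by (simp add: smap_comp_cong)
  ultimately have "smap_comp ?H z ?i = u"
    using is_pullback_property[OF P, of ?H] smap_comp_smap[OF u P'(1)] smap_comp_smap[OF u P'(2)] zi u
    unfolding pullback_property_def by blast
  then show "\<exists>w. is_smap ?S P w \<and> smap_comp ?H w ?i = u \<and> smap_comp ?S s w = v"
    using z by blast
qed

text \<open>The bottom edge of a lifting problem is a single simplex \<open>c\<close> by Yoneda.
  Pulled back along it, the problem has the identity of the standard simplex as bottom edge, and the
  hypothesis at \<open>c\<close> solves it.\<close>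

lemma kan_fibration_local:
  assumes P: "is_pullback P X C Y r s \<pi> t"
    and kan: "\<And>n c. c \<in> simplices C n \<Longrightarrow>
      kan_fibration (fibre_product (simplex n) X (yoneda Y n (t n c)) \<pi>) (simplex n)
        (proj1 (fibre_product (simplex n) X (yoneda Y n (t n c)) \<pi>))"
  shows "kan_fibration P C s"
  unfolding kan_fibration_def
proof (intro conjI allI impI)
  note P' = is_pullback_D[OF P]
  show "is_smap P C s" by (rule P'(2))
  fix n m u v
  let ?H = "horn n m" and ?i = "incl (horn n m)" and ?S = "simplex n"
  assume a: "1 \<le> n \<and> m \<le> n \<and> is_smap ?H P u \<and> is_smap ?S C v \<and> smap_comp ?H s u = smap_comp ?H v ?i"
  then have u: "is_smap ?H P u" and v: "is_smap ?S C v" by blast+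
  have su: "s d (u d z) = v d (?i d z)" if "z \<in> simplices ?H d" for d z
    using a that by (simp add: smap_comp_cong)
  define c where "c = v n (Idn Delta n)"
  have c: "c \<in> simplices C n" unfolding c_def using smap_mem[OF v id_in_simplex] .
  have tv: "smap_comp ?S t v = yoneda Y n (t n c)"
    using smap_comp_yoneda[OF P'(4) c] smap_yoneda[OF v, symmetric] by (simp add: c_def)
  define E where "E = fibre_product ?S X (yoneda Y n (t n c)) \<pi>"
  have E: "is_pullback E X ?S Y (proj2 E) (proj1 E) \<pi> (yoneda Y n (t n c))"
    unfolding E_def
    by (rule is_pullback_fibre_product[OF yoneda_smap[OF smap_ssets(2)[OF P'(4)] smap_mem[OF P'(4) c]] P'(3)])
  have kanE: "kan_fibration E ?S (proj1 E)" unfolding E_def by (rule kan[OF c])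
  note E' = is_pullback_D[OF E]
  note mem = smap_mem[OF u] smap_mem[OF v] smap_mem[OF incl_horn]
  obtain x where x: "is_smap ?H E x" "smap_comp ?H (proj2 E) x = smap_comp ?H r u"
    "smap_comp ?H (proj1 E) x = ?i"
  proof -
    have "smap_comp ?H (yoneda Y n (t n c)) ?i = smap_comp ?H \<pi> (smap_comp ?H r u)"
      unfolding tv[symmetric] using mem by (simp add: smap_comp_cong su[symmetric] P'(5))
    then show ?thesis
      using is_pullback_property[OF E, of ?H] smap_comp_smap[OF u P'(1)] incl_horn that
      unfolding pullback_property_def by blast
  qed
  let ?id = "\<lambda>d. \<lambda>x\<in>simplices ?S d. x"
  have id: "is_smap ?S ?S ?id" by (rule is_smap_id[OF is_sset_simplex])
  have "smap_comp ?H ?id ?i = ?i"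
    by (rule smap_eqI[OF smap_comp_smap[OF incl_horn id] incl_horn]) (simp add: mem)
  \<comment> \<open>With the identity as bottom edge, a filler is a section of the fibration over
    the simplex that extends the given partial section on the horn.\<close>
  then obtain w where w: "is_smap ?S E w" "smap_comp ?H w ?i = x" "smap_comp ?S (proj1 E) w = ?id"
    using kanE[unfolded kan_fibration_def] a x id by metis
  have w1: "proj1 E d (w d y) = y" if "y \<in> simplices ?S d" for d y
    using fun_cong[OF fun_cong[OF w(3)], of d y] that by simp
  obtain z where z: "is_smap ?S P z" "smap_comp ?S r z = smap_comp ?S (proj2 E) w" "smap_comp ?S s z = v"
  proof -
    have "t d (v d y) = \<pi> d (proj2 E d (w d y))" if y: "y \<in> simplices ?S d" for d y
      using E'(5)[OF smap_mem[OF w(1) y]] w1[OF y] fun_cong[OF fun_cong[OF tv], of d y] y by simp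
    then have "smap_comp ?S t v = smap_comp ?S \<pi> (smap_comp ?S (proj2 E) w)"
      by (simp add: smap_comp_cong)
    then show ?thesis
      using is_pullback_property[OF P, of ?S] smap_comp_smap[OF w(1) E'(1)] v that
      unfolding pullback_property_def by blast
  qed
  have zi: "is_smap ?H P (smap_comp ?H z ?i)" using z(1) incl_horn smap_comp_smap by blast
  have rz: "r d (z d y) = proj2 E d (w d y)" "s d (z d y) = v d y" if "y \<in> simplices ?S d" for d y
    using fun_cong[OF fun_cong[OF z(2)], of d y] fun_cong[OF fun_cong[OF z(3)], of d y] that by simp_all
  have wi: "proj2 E d (w d (?i d y)) = r d (u d y)" if "y \<in> simplices ?H d" for d y
    using fun_cong[OF fun_cong[OF w(2)], of d y] x(2) that by (simp add: smap_comp_cong)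
  have "smap_comp ?H r (smap_comp ?H z ?i) = smap_comp ?H r u"
    "smap_comp ?H s (smap_comp ?H z ?i) = smap_comp ?H s u"
    using mem rz wi su by (auto simp: smap_comp_cong)
  moreover have "smap_comp ?H t (smap_comp ?H s u) = smap_comp ?H \<pi> (smap_comp ?H r u)"
    using mem P'(5) by (simp add: smap_comp_cong)
  ultimately have "smap_comp ?H z ?i = u"
    using is_pullback_property[OF P, of ?H] smap_comp_smap[OF u P'(1)] smap_comp_smap[OF u P'(2)] zi u
    unfolding pullback_property_def by blast
  then show "\<exists>w. is_smap ?S P w \<and> smap_comp ?H w ?i = u \<and> smap_comp ?S s w = v"
    using z by blast
qed

section \<open>The universe of Kan fibrations\<close>

abbreviation decode where
  "decode S n A \<equiv> fibre_product (simplex n) (V_tilde S) (yoneda (V_base S) n A) (V_proj S)"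

lemma is_pullback_decode:
  assumes "A \<in> simplices (V_base S) n"
  shows "is_pullback (decode S n A) (V_tilde S) (simplex n) (V_base S)
    (proj2 (decode S n A)) (proj1 (decode S n A)) (V_proj S) (yoneda (V_base S) n A)"
  by (rule is_pullback_fibre_product[OF yoneda_smap[OF is_sset_hs assms] V_proj_smap])

lemma simplices_U_base [simp]:
  "simplices (U_base S) n =
    {A \<in> simplices (V_base S) n. kan_fibration (decode S n A) (simplex n) (proj1 (decode S n A))}"
  by (simp add: U_base_def Let_def)

lemma act_U_base [simp]:
  "\<alpha> \<in> Ar Delta \<Longrightarrow> A \<in> simplices (U_base S) (Cod Delta \<alpha>) \<Longrightarrow> act (U_base S) \<alpha> A = act (V_base S) \<alpha> A"
  by (simp add: U_base_def Let_def)

text \<open>The Kan condition is stable under operators because the map classifying the restricted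
  simplex is the one classifying \<open>A\<close> precomposed with \<alpha>, so
  \<open>kan_fibration_transfer\<close> applies.\<close>

lemma is_sset_U_base: "is_sset (U_base S)"
  unfolding U_base_def Let_def
proof (rule is_sset_sub_sset[OF is_sset_hs])
  fix \<alpha> A
  assume a: "\<alpha> \<in> Ar Delta" and A: "A \<in> simplices (V_base S) (Cod Delta \<alpha>)"
    and kan: "kan_fibration (decode S (Cod Delta \<alpha>) A) (simplex (Cod Delta \<alpha>)) (proj1 (decode S (Cod Delta \<alpha>) A))"
  let ?B = "act (V_base S) \<alpha> A" and ?m = "Dom Delta \<alpha>" and ?n = "Cod Delta \<alpha>"
  have B: "?B \<in> simplices (V_base S) ?m" by (rule act_mem[OF is_sset_hs a A])
  have al: "\<alpha> \<in> simplices (simplex ?n) ?m" using a by (simp add: simplex_def)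
  have e: "yoneda (V_base S) ?m ?B =
      smap_comp (simplex ?m) (yoneda (V_base S) ?n A) (yoneda (simplex ?n) ?m \<alpha>)"
    using smap_comp_yoneda[OF yoneda_smap[OF is_sset_hs A] al] al by (simp add: yoneda_def)
  show "kan_fibration (decode S ?m ?B) (simplex ?m) (proj1 (decode S ?m ?B))"
    by (rule kan_fibration_transfer[OF is_pullback_decode[OF A] is_pullback_decode[OF B] e
          yoneda_smap[OF is_sset_simplex al] kan])
qed

lemma incl_simp [simp]: "x \<in> simplices X n \<Longrightarrow> incl X n x = x"
  by (simp add: incl_def)

lemma is_smap_incl_U: "is_smap (U_base S) (V_base S) (incl (U_base S))"
  using incl_sub_sset[OF is_sset_hs] is_sset_U_base unfolding U_base_def by blast

lemma is_pullback_U: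
  "is_pullback (U_tilde S) (V_tilde S) (U_base S) (V_base S) (proj2 (U_tilde S)) (U_proj S) (V_proj S)
    (incl (U_base S))"
  unfolding U_proj_def U_tilde_def by (rule is_pullback_fibre_product[OF is_smap_incl_U V_proj_smap])

lemma simplices_U_tilde [simp]:
  "simplices (U_tilde S) n =
    {(A, F). A \<in> simplices (U_base S) n \<and> F \<in> simplices (V_tilde S) n \<and> A = V_proj S n F}"
  unfolding U_tilde_def by auto

lemma U_proj_simp [simp]: "x \<in> simplices (U_tilde S) n \<Longrightarrow> U_proj S n x = fst x"
  by (simp add: U_proj_def proj1_def)

lemma act_U_tilde [simp]:
  "\<alpha> \<in> Ar Delta \<Longrightarrow> (A, F) \<in> simplices (U_tilde S) (Cod Delta \<alpha>) \<Longrightarrow>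
    act (U_tilde S) \<alpha> (A, F) = (act (V_base S) \<alpha> A, act (V_tilde S) \<alpha> F)"
  unfolding U_tilde_def by simp

text \<open>With the inclusion of U as classifying map, the local condition is exactly membership in
  U.\<close>

lemma kan_fibration_U_proj: "kan_fibration (U_tilde S) (U_base S) (U_proj S)"
  by (rule kan_fibration_local[OF is_pullback_U]) simp

lemma small_map_U_proj:
  assumes "small_sets \<kappa> S"
  shows "small_map \<kappa> (U_tilde S) (U_base S) (U_proj S)"
  unfolding small_map_def
proof (intro conjI allI ballI)
  show "is_smap (U_tilde S) (U_base S) (U_proj S)" using is_pullback_D(2)[OF is_pullback_U] .
  fix n A assume A: "A \<in> simplices (U_base S) n"
  let ?X = "on_ob A (Idn Delta n)"
  let ?f = "{e \<in> simplices (U_tilde S) n. U_proj S n e = A}"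
  have "inj_on (\<lambda>e. pt n (snd e)) ?f" by (rule inj_onI) (auto intro: V_tilde_eqI)
  moreover have "(\<lambda>e. pt n (snd e)) ` ?f \<subseteq> ?X" using V_tilde_D(3) by auto
  ultimately have "|?f| \<le>o |?X|" using card_of_ordLeq by blast
  moreover have "|?X| <o \<kappa>" using assms V_D(1)[of A S n "Idn Delta n"] A by (auto simp: small_sets_def Delta_Idn)
  ultimately show "|?f| <o \<kappa>" using ordLeq_ordLess_trans by blast
qed

text \<open>Corestriction along U. By Yoneda, each \<open>k n b\<close> classifies the pullback of
  \<open>p\<close> along \<open>b\<close>, hence a Kan fibration, so \<open>k\<close> lands in U.
  The top map acquires a first component because simplices of \<open>U_tilde\<close> are
  pairs.\<close>

lemma is_pullback_into_U:
  assumes P: "is_pullback E (V_tilde S) B (V_base S) l p (V_proj S) k" and kan: "kan_fibration E B p"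
  shows "is_pullback E (U_tilde S) B (U_base S) (\<lambda>n. \<lambda>e\<in>simplices E n. (k n (p n e), l n e)) p (U_proj S) k"
proof -
  note P' = is_pullback_D[OF P]
  note ss = smap_ssets(2)[OF P'(2)] smap_ssets(1)[OF P'(2)]
  have kU: "k n b \<in> simplices (U_base S) n" if b: "b \<in> simplices B n" for n b
  proof -
    have kb: "k n b \<in> simplices (V_base S) n" using smap_mem[OF P'(4) b] .
    have "kan_fibration (decode S n (k n b)) (simplex n) (proj1 (decode S n (k n b)))"
      by (rule kan_fibration_transfer[OF P is_pullback_decode[OF kb] smap_comp_yoneda[OF P'(4) b, symmetric]
            yoneda_smap[OF ss(1) b] kan])
    with kb show ?thesis by simp
  qed
  let ?l = "\<lambda>n. \<lambda>e\<in>simplices E n. (k n (p n e), l n e)"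
  have k: "is_smap B (U_base S) k"
    unfolding is_smap_def
  proof (intro conjI allI ballI ss is_sset_U_base)
    show "k n \<in> simplices B n \<rightarrow>\<^sub>E simplices (U_base S) n" for n
      using kU P'(4) by (auto simp: is_smap_def PiE_def)
    show "k (Dom Delta \<alpha>) (act B \<alpha> x) = act (U_base S) \<alpha> (k (Cod Delta \<alpha>) x)"
      if "\<alpha> \<in> Ar Delta" "x \<in> simplices B (Cod Delta \<alpha>)" for \<alpha> x
      using smap_act[OF P'(4) that] kU[OF that(2)] that by simp
  qed
  have lm: "(k n (p n e), l n e) \<in> simplices (U_tilde S) n" if "e \<in> simplices E n" for n e
    using kU[OF smap_mem[OF P'(2) that]] smap_mem[OF P'(1) that] P'(5)[OF that] by simp
  have l: "is_smap E (U_tilde S) ?l"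
  proof (rule is_smapI[OF ss(2) _ lm])
    show "is_sset (U_tilde S)" by (rule smap_ssets(1)[OF is_pullback_D(1)[OF is_pullback_U]])
    show "(k (Dom Delta \<alpha>) (p (Dom Delta \<alpha>) (act E \<alpha> x)), l (Dom Delta \<alpha>) (act E \<alpha> x)) =
      act (U_tilde S) \<alpha> (k (Cod Delta \<alpha>) (p (Cod Delta \<alpha>) x), l (Cod Delta \<alpha>) x)"
      if "\<alpha> \<in> Ar Delta" "x \<in> simplices E (Cod Delta \<alpha>)" for \<alpha> x
      using smap_act[OF P'(1) that] smap_act[OF P'(2) that] smap_act[OF P'(4) that(1) smap_mem[OF P'(2) that(2)]]
        lm[OF that(2)] that(1) by (simp del: simplices_U_tilde)
  qed
  have "bij_betw (\<lambda>e. (p n e, ?l n e)) (simplices E n)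
    {(b, x). b \<in> simplices B n \<and> x \<in> simplices (U_tilde S) n \<and> k n b = U_proj S n x}" for n
  proof -
    \<comment> \<open>Over \<open>b\<close>, the first component of a simplex of
      \<open>U_tilde\<close> can only be \<open>k n b\<close>, so adding or dropping it is a
      bijection.\<close>
    let ?f = "\<lambda>(b, F). (b, k n b, F)"
    have kV: "U_proj S n (V_proj S n F, F) = V_proj S n F"
      if "b \<in> simplices B n" "F \<in> simplices (V_tilde S) n" "k n b = V_proj S n F" for b F
      using kU[OF that(1)] that by simp
    have "bij_betw ?f {(b, F). b \<in> simplices B n \<and> F \<in> simplices (V_tilde S) n \<and> k n b = V_proj S n F}
      {(b, x). b \<in> simplices B n \<and> x \<in> simplices (U_tilde S) n \<and> k n b = U_proj S n x}"
      using kU[of _ n] kV by (intro bij_betwI[of _ _ _ "\<lambda>(b, A, F). (b, F)"]) (auto intro!: kV[symmetric])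
    from bij_betw_trans[OF P'(6) this] show ?thesis
      by (rule bij_betw_cong[THEN iffD1, rotated]) auto
  qed
  moreover have "smap_comp E k p = smap_comp E (U_proj S) ?l" using U_proj_simp[OF lm] by (simp add: smap_comp_cong)
  ultimately show ?thesis
    using k l P'(2) is_pullback_D(2)[OF is_pullback_U] unfolding is_pullback_def by simp
qed

section \<open>Realignment\<close>

text \<open>The labellings are only fibrewise bijections and need not respect operators: the
  restriction maps of \<open>k\<close> are the action of \<open>E\<close> conjugated by them, and so
  inherit its laws. The last three conclusions let \<open>k\<close> and \<open>l\<close> be compared
  with other maps.\<close>

lemma realise_presheaf:
  assumes p: "is_smap E B p"
    and T: "\<And>n b. b \<in> simplices B n \<Longrightarrow> T n b \<in> S"
    and bij: "\<And>n b. b \<in> simplices B n \<Longrightarrow> bij_betw (\<theta> n) {e \<in> simplices E n. p n e = b} (T n b)"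
  obtains l k where "is_pullback E (V_tilde S) B (V_base S) l p (V_proj S) k"
    and "\<And>n b f. b \<in> simplices B n \<Longrightarrow> f \<in> Ar Delta \<Longrightarrow> Cod Delta f = n \<Longrightarrow>
      on_ob (k n b) f = T (Dom Delta f) (act B f b)"
    and "\<And>n b f u e. b \<in> simplices B n \<Longrightarrow> f \<in> Ar Delta \<Longrightarrow> Cod Delta f = n \<Longrightarrow> u \<in> Ar Delta \<Longrightarrow>
      Cod Delta u = Dom Delta f \<Longrightarrow> e \<in> simplices E (Dom Delta f) \<Longrightarrow> p (Dom Delta f) e = act B f b \<Longrightarrow>
      res (k n b) f u (\<theta> (Dom Delta f) e) = \<theta> (Dom Delta u) (act E u e)"
    and "\<And>n e. e \<in> simplices E n \<Longrightarrow> pt n (l n e) = \<theta> n e"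
proof -
  note B = smap_ssets(2)[OF p] and E = smap_ssets(1)[OF p]
  \<comment> \<open>Restriction decodes a label to a simplex of \<open>E\<close> over the
    restriction of \<open>b\<close> along \<open>f\<close>, acts by \<open>u\<close> there, and
    encodes the result.\<close>
  define r where "r b f u x = \<theta> (Dom Delta u) (act E u
    (the_inv_into {e \<in> simplices E (Dom Delta f). p (Dom Delta f) e = act B f b} (\<theta> (Dom Delta f)) x))" for b f u x
  define X where "X b f = T (Dom Delta f) (act B f b)" for b f
  define k where "k n = (\<lambda>b\<in>simplices B n. mk_psh n (X b) (r b))" for n
  define l where "l n = (\<lambda>e\<in>simplices E n. lift n (k n (p n e)) (\<theta> n e))" for n
  have actB: "act B f b \<in> simplices B (Dom Delta f)" if "f \<in> Ar Delta" "Cod Delta f = n" "b \<in> simplices B n" for f n b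
    using act_mem[OF B] that by blast
  have actE: "act E u e \<in> simplices E (Dom Delta u)" "p (Dom Delta u) (act E u e) = act B (Cmp Delta f u) b"
    if "f \<in> Ar Delta" "b \<in> simplices B (Cod Delta f)" "u \<in> Ar Delta" "Cod Delta u = Dom Delta f"
      "e \<in> simplices E (Dom Delta f)" "p (Dom Delta f) e = act B f b" for f b u e
    using that act_mem[OF E, of u e] smap_act[OF p, of u e] act_Cmp[OF B, of u f b] by simp_all
  have X_obtain: "\<exists>e. e \<in> simplices E (Dom Delta f) \<and> p (Dom Delta f) e = act B f b \<and> x = \<theta> (Dom Delta f) e"
    if "x \<in> X b f" "f \<in> Ar Delta" "b \<in> simplices B (Cod Delta f)" for x b f
    using that bij[OF actB[OF that(2) refl that(3)]] unfolding X_def bij_betw_def by auto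
  have \<theta>_mem: "\<theta> n e \<in> T n b" if "e \<in> simplices E n" "p n e = b" for n e b
    using bij[OF smap_mem[OF p that(1)]] that unfolding bij_betw_def by auto
  \<comment> \<open>Since every element of \<open>X b f\<close> is a label \<theta> e, this formula
    replaces the inverse in the definition of \<open>r\<close>, and the presheaf laws become laws of
    \<open>E\<close>.\<close>
  have r: "r b f u (\<theta> (Dom Delta f) e) = \<theta> (Dom Delta u) (act E u e)"
    if "f \<in> Ar Delta" "b \<in> simplices B (Cod Delta f)" "e \<in> simplices E (Dom Delta f)" "p (Dom Delta f) e = act B f b"
    for b f u e
    using bij[OF actB[OF that(1) refl that(2)]] that unfolding r_def bij_betw_def
    by (subst the_inv_into_f_f) auto
  have kV: "k n b \<in> simplices (V_base S) n" if b: "b \<in> simplices B n" for n b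
  proof -
    have "mk_psh n (X b) (r b) \<in> simplices (V_base S) n"
    proof (rule mk_psh_in_V)
      fix f assume f: "f \<in> Ar Delta" "Cod Delta f = n"
      show "X b f \<in> S" unfolding X_def using T[OF actB[OF f b]] .
      have b': "b \<in> simplices B (Cod Delta f)" using b f by simp
      fix x assume "x \<in> X b f"
      from X_obtain[OF this f(1) b'] obtain e where e: "e \<in> simplices E (Dom Delta f)" "p (Dom Delta f) e = act B f b"
        and x: "x = \<theta> (Dom Delta f) e" by blast
      show "r b f (Idn Delta (Dom Delta f)) x = x"
        unfolding x using r[OF f(1) b' e] act_Idn[OF E e(1)] by simp
      fix u assume u: "u \<in> Ar Delta" "Cod Delta u = Dom Delta f"
      note fu = Delta_Cmp[OF u(1) f(1) u(2)]
      note ue = actE[OF f(1) b' u e]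
      show "r b f u x \<in> X b (Cmp Delta f u)"
        unfolding x r[OF f(1) b' e] X_def using \<theta>_mem[OF ue] fu by simp
      fix v assume v: "v \<in> Ar Delta" "Cod Delta v = Dom Delta u"
      show "r b f (Cmp Delta u v) x = r b (Cmp Delta f u) v (r b f u x)"
        unfolding x r[OF f(1) b' e]
        using r[of "Cmp Delta f u" b "act E u e" v] fu ue b f act_Cmp[OF E v(1) u(1) v(2)] e(1) u
          Delta_Cmp[OF v(1) u(1) v(2)] by simp
    qed
    then show ?thesis using b by (simp add: k_def)
  qed
  have k_ob: "on_ob (k n b) f = X b f" if "b \<in> simplices B n" "f \<in> Ar Delta" "Cod Delta f = n" for n b f
    using that mk_psh_simps(1) by (simp add: k_def)
  have k_res: "res (k n b) f u (\<theta> (Dom Delta f) e) = \<theta> (Dom Delta u) (act E u e)"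
    if "b \<in> simplices B n" "f \<in> Ar Delta" "Cod Delta f = n" "u \<in> Ar Delta" "Cod Delta u = Dom Delta f"
      "e \<in> simplices E (Dom Delta f)" "p (Dom Delta f) e = act B f b" for n b f u e
    using that mk_psh_simps(2)[of f n u "\<theta> (Dom Delta f) e" "X b" "r b"] \<theta>_mem[OF that(6,7)] r[OF that(2) _ that(6,7)]
    by (simp add: k_def X_def)
  have k: "is_smap B (V_base S) k"
    unfolding k_def
  proof (rule is_smapI[OF B is_sset_hs])
    show "mk_psh n (X b) (r b) \<in> simplices (V_base S) n" if "b \<in> simplices B n" for n b
      using kV[OF that] that by (simp add: k_def)
    fix \<alpha> b assume a: "\<alpha> \<in> Ar Delta" and b: "b \<in> simplices B (Cod Delta \<alpha>)"
    let ?m = "Dom Delta \<alpha>" and ?n = "Cod Delta \<alpha>" and ?b = "act B \<alpha> b"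
    have b': "?b \<in> simplices B ?m" by (rule act_mem[OF B a b])
    have bf: "act B f ?b = act B (Cmp Delta \<alpha> f) b" if "f \<in> Ar Delta" "Cod Delta f = ?m" for f
      using act_Cmp[OF B that(1) a that(2) b] by simp
    \<comment> \<open>Naturality is an equality of functors: at \<open>f\<close> both sides are
      computed from the same simplex, the restriction of \<open>b\<close> along \<alpha> f.\<close>
    have "k ?m ?b = act (V_base S) \<alpha> (k ?n b)"
    proof (rule V_eqI[OF kV[OF b'] act_mem[OF is_sset_hs a kV[OF b]]])
      fix f assume f: "f \<in> Ar Delta" "Cod Delta f = ?m"
      note af = Delta_Cmp[OF f(1) a f(2)]
      show "on_ob (k ?m ?b) f = on_ob (act (V_base S) \<alpha> (k ?n b)) f"
        using act_hs(1)[OF a kV[OF b] f] k_ob[OF b' f] k_ob[OF b, of "Cmp Delta \<alpha> f"] af bf[OF f]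
        by (simp add: X_def)
      fix u x assume u: "u \<in> Ar Delta" "Cod Delta u = Dom Delta f" and "x \<in> on_ob (k ?m ?b) f"
      then have "x \<in> X ?b f" using k_ob[OF b' f] by simp
      from X_obtain[OF this f(1)] obtain e where e: "e \<in> simplices E (Dom Delta f)"
        "p (Dom Delta f) e = act B f ?b" and x: "x = \<theta> (Dom Delta f) e" using b' f by auto
      show "res (k ?m ?b) f u x = res (act (V_base S) \<alpha> (k ?n b)) f u x"
        using act_V[OF a kV[OF b] f u] k_res[OF b' f u e] k_res[OF b, of "Cmp Delta \<alpha> f" u e] af bf[OF f] u e
        by (simp add: x)
    qed
    then show "mk_psh ?m (X ?b) (r ?b) = act (V_base S) \<alpha> (mk_psh ?n (X b) (r b))"
      using b b' by (simp add: k_def)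
  qed
  have k_Idn: "on_ob (k n b) (Idn Delta n) = T n b" if "b \<in> simplices B n" for n b
    using k_ob[OF that Delta_Idn] act_Idn[OF B that] by (simp add: X_def)
  have lift: "lift n (k n (p n e)) (\<theta> n e) \<in> simplices (V_tilde S) n"
    "V_proj S n (lift n (k n (p n e)) (\<theta> n e)) = k n (p n e)" "pt n (lift n (k n (p n e)) (\<theta> n e)) = \<theta> n e"
    if e: "e \<in> simplices E n" for n e
  proof -
    have "\<theta> n e \<in> on_ob (k n (p n e)) (Idn Delta n)"
      using k_Idn[OF smap_mem[OF p e]] \<theta>_mem[OF e refl] by simp
    then show "lift n (k n (p n e)) (\<theta> n e) \<in> simplices (V_tilde S) n"
      "V_proj S n (lift n (k n (p n e)) (\<theta> n e)) = k n (p n e)" "pt n (lift n (k n (p n e)) (\<theta> n e)) = \<theta> n e"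
      using lift_in_V_tilde[OF kV[OF smap_mem[OF p e]]] by simp_all
  qed
  have l: "is_smap E (V_tilde S) l"
    unfolding l_def
  proof (rule is_smapI[OF E is_sset_hs lift(1)])
    fix \<alpha> e assume a: "\<alpha> \<in> Ar Delta" and e: "e \<in> simplices E (Cod Delta \<alpha>)"
    let ?m = "Dom Delta \<alpha>" and ?n = "Cod Delta \<alpha>"
    let ?L = "lift ?n (k ?n (p ?n e)) (\<theta> ?n e)"
    note e' = act_mem[OF E a e]
    note pe = smap_mem[OF p e]
    show "lift ?m (k ?m (p ?m (act E \<alpha> e))) (\<theta> ?m (act E \<alpha> e)) = act (V_tilde S) \<alpha> ?L"
    proof (rule V_tilde_eqI[OF lift(1)[OF e'] act_mem[OF is_sset_hs a lift(1)[OF e]]])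
      show "V_proj S ?m (lift ?m (k ?m (p ?m (act E \<alpha> e))) (\<theta> ?m (act E \<alpha> e))) =
          V_proj S ?m (act (V_tilde S) \<alpha> ?L)"
        unfolding smap_act[OF V_proj_smap a lift(1)[OF e]] lift(2)[OF e] lift(2)[OF e']
        unfolding smap_act[OF p a e]
        by (rule smap_act[OF k a pe])
      \<comment> \<open>The points match by \<open>k_res\<close> at the terminal object, where
        restriction along \<alpha> takes the label of \<open>e\<close> to the label of its
        restriction.\<close>
      show "pt ?m (lift ?m (k ?m (p ?m (act E \<alpha> e))) (\<theta> ?m (act E \<alpha> e))) = pt ?m (act (V_tilde S) \<alpha> ?L)"
        unfolding pt_act[OF a lift(1)[OF e]] lift(2)[OF e] lift(3)[OF e] lift(3)[OF e']
        using k_res[where n = ?n and b = "p ?n e" and f = "Idn Delta ?n" and u = \<alpha> and e = e] Delta_Idn a pe e act_Idn[OF B pe] by simp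
    qed
  qed
  have lD: "V_proj S n (l n e) = k n (p n e)" "pt n (l n e) = \<theta> n e" if "e \<in> simplices E n" for n e
    using lift[OF that] that by (simp_all add: l_def)
  have "bij_betw (\<lambda>e. (p n e, l n e)) (simplices E n)
    {(b, F). b \<in> simplices B n \<and> F \<in> simplices (V_tilde S) n \<and> k n b = V_proj S n F}" (is "bij_betw ?f _ ?R") for n
    unfolding bij_betw_def
  proof
    show "inj_on ?f (simplices E n)"
    proof (rule inj_onI)
      fix e e' assume e: "e \<in> simplices E n" "e' \<in> simplices E n" "?f e = ?f e'"
      then have "\<theta> n e = \<theta> n e'" using lD(2)[OF e(1)] lD(2)[OF e(2)] by simp
      then show "e = e'" using bij[OF smap_mem[OF p e(1)]] e unfolding bij_betw_def inj_on_def by auto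
    qed
    show "?f ` simplices E n = ?R"
    proof
      show "?f ` simplices E n \<subseteq> ?R" using smap_mem[OF p] smap_mem[OF l] lD(1) by auto
      show "?R \<subseteq> ?f ` simplices E n"
      proof clarify
        fix b F assume b: "b \<in> simplices B n" and F: "F \<in> simplices (V_tilde S) n" and eq: "k n b = V_proj S n F"
        \<comment> \<open>The point of \<open>F\<close> is a label in \<open>T n b\<close>; the
          simplex \<open>e\<close> carrying this label is the preimage.\<close>
        have "pt n F \<in> T n b" using V_tilde_D(3)[OF F] k_Idn[OF b] eq by simp
        then obtain e where e: "e \<in> simplices E n" "p n e = b" "pt n F = \<theta> n e"
          using bij[OF b] unfolding bij_betw_def by auto
        have "l n e = F"
          by (rule V_tilde_eqI[OF smap_mem[OF l e(1)] F]) (use lD[OF e(1)] e eq in simp_all)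
        then show "(b, F) \<in> ?f ` simplices E n" using e by auto
      qed
    qed
  qed
  moreover have "smap_comp E k p = smap_comp E (V_proj S) l" using lD by (simp add: smap_comp_cong)
  ultimately have "is_pullback E (V_tilde S) B (V_base S) l p (V_proj S) k"
    using k l p V_proj_smap by (simp add: is_pullback_def)
  then show thesis by (rule that) (rule k_ob[unfolded X_def] k_res lD(2); assumption)+
qed

text \<open>\<open>small_sets\<close> speaks of cardinals on the carrier type of \<kappa>, while
  \<open>X\<close> has a type of its own. An injection of \<open>X\<close> into the field of
  \<kappa> produces an image whose cardinal can serve there.\<close>

lemma small_sets_bij:
  fixes \<kappa> :: "'k rel" and X :: "'e set" and S :: "'u set set"
  assumes \<kappa>: "Card_order \<kappa>" and S: "small_sets \<kappa> S" and X: "|X| <o \<kappa>"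
  obtains Y f where "Y \<in> S" "bij_betw f X Y"
proof -
  have "|X| \<le>o |Field \<kappa>|"
    using X card_of_Field_ordIso[OF \<kappa>] by (meson ordIso_symmetric ordLess_imp_ordLeq ordLeq_ordIso_trans)
  then obtain f :: "'e \<Rightarrow> 'k" where f: "inj_on f X" unfolding card_of_ordLeq[symmetric] by auto
  have c: "|X| =o |f ` X|" by (rule card_of_ordIsoI[OF inj_on_imp_bij_betw[OF f]])
  have "|f ` X| <o \<kappa>" by (rule ordIso_ordLess_trans[OF ordIso_symmetric[OF c] X])
  then have "\<exists>Y\<in>S. |Y| =o |f ` X|"
    using S card_of_Card_order[of "f ` X"] by (simp add: small_sets_def)
  then obtain Y where Y: "Y \<in> S" "|Y| =o |f ` X|" by auto
  have "|X| =o |Y|" by (rule ordIso_transitive[OF c ordIso_symmetric[OF Y(2)]])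
  then obtain g where "bij_betw g X Y" unfolding card_of_ordIso[symmetric] by auto
  then show thesis by (rule that[OF Y(1)])
qed

text \<open>This names the fibre of the universe by a set belonging to \<open>S\<close>. It supplies
  the labels over the image of \<open>i\<close>, with \<open>lift\<close> as the inverse.\<close>

lemma bij_betw_pt:
  assumes "A \<in> simplices (U_base S) n"
  shows "bij_betw (\<lambda>x. pt n (snd x)) {x \<in> simplices (U_tilde S) n. U_proj S n x = A} (on_ob A (Idn Delta n))"
proof -
  have A: "A \<in> simplices (V_base S) n" using assms by simp
  note L = lift_in_V_tilde[OF A]
  show ?thesis
  proof (rule bij_betwI[of _ _ _ "\<lambda>x. (A, lift n A x)"])
    show "(\<lambda>x. pt n (snd x)) \<in> {x \<in> simplices (U_tilde S) n. U_proj S n x = A} \<rightarrow> on_ob A (Idn Delta n)"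
      using V_tilde_D(3) by auto
    show "(\<lambda>x. (A, lift n A x)) \<in> on_ob A (Idn Delta n) \<rightarrow> {x \<in> simplices (U_tilde S) n. U_proj S n x = A}"
    proof
      fix x assume "x \<in> on_ob A (Idn Delta n)"
      then have "(A, lift n A x) \<in> simplices (U_tilde S) n" using L assms by simp
      then show "(A, lift n A x) \<in> {x \<in> simplices (U_tilde S) n. U_proj S n x = A}"
        using U_proj_simp by fastforce
    qed
    show "pt n (snd (A, lift n A x)) = x" if "x \<in> on_ob A (Idn Delta n)" for x using L that by simp
    fix x assume "x \<in> {x \<in> simplices (U_tilde S) n. U_proj S n x = A}"
    then obtain F where x: "x = (A, F)" and F: "F \<in> simplices (V_tilde S) n" "A = V_proj S n F" by force
    have m: "pt n F \<in> on_ob A (Idn Delta n)" using V_tilde_D(3)[OF F(1)] F(2) by simp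
    have "lift n A (pt n F) = F"
      by (rule V_tilde_eqI[OF L(1)[OF m] F(1)]) (use L[OF m] F(2) in simp_all)
    then show "(A, lift n A (pt n (snd x))) = x" by (simp add: x)
  qed
qed

lemma realignment:
  assumes \<kappa>: "Card_order \<kappa>" and S: "small_sets \<kappa> S"
    and i: "is_mono A B i" and E: "small_kan_fibration \<kappa> E B p"
    and P: "is_pullback D E A B j q p i" and Q: "is_pullback D (U_tilde S) A (U_base S) g q (U_proj S) h"
  obtains l k where "is_pullback E (U_tilde S) B (U_base S) l p (U_proj S) k"
    "smap_comp A k i = h" "smap_comp D l j = g"
proof -
  note P' = is_pullback_D[OF P] and Q' = is_pullback_D[OF Q]
  note ss = smap_ssets(1)[OF P'(1)] smap_ssets(2)[OF P'(1)] smap_ssets(1)[OF P'(4)] smap_ssets(2)[OF P'(4)]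
  have kan: "kan_fibration E B p" and small: "\<And>n b. b \<in> simplices B n \<Longrightarrow> |{e \<in> simplices E n. p n e = b}| <o \<kappa>"
    using E by (auto simp: small_kan_fibration_def small_map_def)
  have inj: "a = a'" if "i n a = i n a'" "a \<in> simplices A n" "a' \<in> simplices A n" for n a a'
    using i that unfolding is_mono_def inj_on_def by blast
  \<comment> \<open>The conditions on a label set and a labelling at one simplex \<open>b\<close>.
    The clause on preimages is vacuous off the image of \<open>i\<close>; on the image it prescribes
    both by \<open>h\<close> and \<open>g\<close>.\<close>
  define good where "good n b X t \<longleftrightarrow> X \<in> S \<and> bij_betw t {e \<in> simplices E n. p n e = b} X \<and>
    (\<forall>a\<in>simplices A n. i n a = b \<longrightarrow> X = on_ob (h n a) (Idn Delta n) \<and>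
      (\<forall>d\<in>simplices D n. q n d = a \<longrightarrow> t (j n d) = pt n (snd (g n d))))" for n b X t
  have "\<exists>X t. good n b X t" if b: "b \<in> simplices B n" for n b
  proof (cases "\<exists>a\<in>simplices A n. i n a = b")
    case True
    then obtain a where a: "a \<in> simplices A n" "i n a = b" by blast
    let ?Da = "{d \<in> simplices D n. q n d = a}"
    have h: "h n a \<in> simplices (U_base S) n" by (rule smap_mem[OF Q'(4) a(1)])
    \<comment> \<open>From the fibre of \<open>E\<close> back along \<open>j\<close> to
      \<open>D\<close>, across by \<open>g\<close> to the fibre of \<open>U_tilde\<close>, and then
      to the point.\<close>
    define t where "t = (\<lambda>x. pt n (snd x)) \<circ> g n \<circ> the_inv_into ?Da (j n)"
    have jb: "bij_betw (j n) ?Da {e \<in> simplices E n. p n e = b}"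
      using is_pullback_bij_fibre[OF P a(1)] a(2) by simp
    have "bij_betw t {e \<in> simplices E n. p n e = b} (on_ob (h n a) (Idn Delta n))"
      unfolding t_def
      by (intro bij_betw_trans[OF bij_betw_the_inv_into[OF jb]]
          bij_betw_trans[OF is_pullback_bij_fibre[OF Q a(1)] bij_betw_pt[OF h]])
    moreover have "t (j n d) = pt n (snd (g n d))" if "d \<in> ?Da" for d
      using jb that unfolding bij_betw_def t_def by (simp add: the_inv_into_f_f)
    moreover have "on_ob (h n a) (Idn Delta n) \<in> S"
      using h V_D(1)[of "h n a" S n "Idn Delta n"] by (simp add: Delta_Idn)
    \<comment> \<open>\<open>good\<close> quantifies over all preimages of \<open>b\<close>;
      injectivity of \<open>i\<close> leaves only \<open>a\<close>.\<close>
    ultimately have "good n b (on_ob (h n a) (Idn Delta n)) t"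
      unfolding good_def using inj[of n a] a by blast
    then show ?thesis by blast
  next
    case False
    obtain X t where "X \<in> S" "bij_betw t {e \<in> simplices E n. p n e = b} X"
      using small_sets_bij[OF \<kappa> S small[OF b]] .
    then have "good n b X t" using False by (simp add: good_def)
    then show ?thesis by blast
  qed
  \<comment> \<open>Set and labelling are chosen as a pair, since the labelling takes its values in
    the chosen set.\<close>
  then have "\<forall>n b. \<exists>W. b \<in> simplices B n \<longrightarrow> good n b (fst W) (snd W)"
    by (simp add: split_paired_Ex)
  then obtain W where W: "\<forall>n b. b \<in> simplices B n \<longrightarrow> good n b (fst (W n b)) (snd (W n b))"
    unfolding choice_iff by blast
  define T t where "T n b = fst (W n b)" and "t n b = snd (W n b)" for n b
  have good: "good n b (T n b) (t n b)" if "b \<in> simplices B n" for n b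
    using W that by (simp add: T_def t_def)
  \<comment> \<open>Distinct fibres of \<open>p\<close> are disjoint, so the labellings glue to one
    function in each dimension.\<close>
  define \<theta> where "\<theta> n e = t n (p n e) e" for n e
  have T: "T n b \<in> S" if "b \<in> simplices B n" for n b using good[OF that] by (simp add: good_def)
  have bij: "bij_betw (\<theta> n) {e \<in> simplices E n. p n e = b} (T n b)" if "b \<in> simplices B n" for n b
  proof -
    have "bij_betw (t n b) {e \<in> simplices E n. p n e = b} (T n b)" using good[OF that] by (simp add: good_def)
    then show ?thesis by (rule bij_betw_cong[THEN iffD1, rotated]) (simp add: \<theta>_def)
  qed
  have Ti: "T n (i n a) = on_ob (h n a) (Idn Delta n)" if "a \<in> simplices A n" for n a
    using good[OF smap_mem[OF P'(4) that]] that by (simp add: good_def)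
  have \<theta>j: "\<theta> n (j n d) = pt n (snd (g n d))" if "d \<in> simplices D n" for n d
    using good[OF smap_mem[OF P'(4) smap_mem[OF P'(2) that]]] that P'(5)[OF that] smap_mem[OF P'(2) that]
    by (simp add: good_def \<theta>_def)
  obtain l k where K: "is_pullback E (V_tilde S) B (V_base S) l p (V_proj S) k"
    and k_ob: "\<And>n b f. b \<in> simplices B n \<Longrightarrow> f \<in> Ar Delta \<Longrightarrow> Cod Delta f = n \<Longrightarrow>
      on_ob (k n b) f = T (Dom Delta f) (act B f b)"
    and k_res: "\<And>n b f u e. b \<in> simplices B n \<Longrightarrow> f \<in> Ar Delta \<Longrightarrow> Cod Delta f = n \<Longrightarrow> u \<in> Ar Delta \<Longrightarrow>
      Cod Delta u = Dom Delta f \<Longrightarrow> e \<in> simplices E (Dom Delta f) \<Longrightarrow> p (Dom Delta f) e = act B f b \<Longrightarrow>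
      res (k n b) f u (\<theta> (Dom Delta f) e) = \<theta> (Dom Delta u) (act E u e)"
    and l_pt: "\<And>n e. e \<in> simplices E n \<Longrightarrow> pt n (l n e) = \<theta> n e"
    apply (rule realise_presheaf[OF P'(3) T bij])
      apply assumption
     apply assumption
    subgoal premises prems for l k by (rule prems(1)[OF prems(2-5)])
    done
  note K' = is_pullback_D[OF K]
  note PU = is_pullback_into_U[OF K kan]
  note PU' = is_pullback_D[OF PU]
  have gU: "snd (g n d) \<in> simplices (V_tilde S) n" "V_proj S n (snd (g n d)) = h n (q n d)"
    "g n d = (h n (q n d), snd (g n d))" if "d \<in> simplices D n" for n d
  proof -
    have "g n d \<in> simplices (U_tilde S) n" "h n (q n d) = fst (g n d)"
      using smap_mem[OF Q'(1) that] Q'(5)[OF that] U_proj_simp[of "g n d"] by simp_all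
    then show "snd (g n d) \<in> simplices (V_tilde S) n" "V_proj S n (snd (g n d)) = h n (q n d)"
      "g n d = (h n (q n d), snd (g n d))" by (auto simp: prod_eq_iff)
  qed
  have hV: "h n a \<in> simplices (V_base S) n" if "a \<in> simplices A n" for n a
    using smap_mem[OF Q'(4) that] by simp
  have h_act: "h (Dom Delta f) (act A f a) = act (V_base S) f (h (Cod Delta f) a)"
    if "f \<in> Ar Delta" "a \<in> simplices A (Cod Delta f)" for f a
    using smap_act[OF Q'(4) that] smap_mem[OF Q'(4) that(2)] that(1) by simp
  \<comment> \<open>At \<open>f\<close> both sides are the value of \<open>h\<close> at the identity
    for the simplex \<open>a\<close> restricted along \<open>f\<close>, as \<open>i\<close> and
    \<open>h\<close> commute with operators.\<close>
  have ki: "k n (i n a) = h n a" if a: "a \<in> simplices A n" for n a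
  proof (rule V_eqI[OF smap_mem[OF K'(4) smap_mem[OF P'(4) a]] hV[OF a]])
    fix f assume f: "f \<in> Ar Delta" "Cod Delta f = n"
    let ?m = "Dom Delta f" and ?a = "act A f a"
    have a': "a \<in> simplices A (Cod Delta f)" using a f by simp
    have af: "?a \<in> simplices A ?m" by (rule act_mem[OF ss(3) f(1) a'])
    have ia: "act B f (i n a) = i ?m ?a" using smap_act[OF P'(4) f(1) a'] f by simp
    have ob: "on_ob (k n (i n a)) f = on_ob (h ?m ?a) (Idn Delta ?m)"
      using k_ob[OF smap_mem[OF P'(4) a] f] ia Ti[OF af] by simp
    show "on_ob (k n (i n a)) f = on_ob (h n a) f"
      using ob act_hs(1)[OF f(1) hV[OF a'], of "Idn Delta ?m"] h_act[OF f(1) a'] f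
      by (simp add: Delta_Idn Delta_id)
    fix u x assume u: "u \<in> Ar Delta" "Cod Delta u = ?m" and "x \<in> on_ob (k n (i n a)) f"
    then have "x \<in> T ?m (i ?m ?a)" using ob Ti[OF af] by simp
    then obtain e where e: "e \<in> simplices E ?m" "p ?m e = i ?m ?a" "x = \<theta> ?m e"
      using bij[OF smap_mem[OF P'(4) af]] unfolding bij_betw_def by auto
    then obtain d where d: "d \<in> simplices D ?m" "q ?m d = ?a" "e = j ?m d"
      using is_pullback_bij_fibre[OF P af] unfolding bij_betw_def by auto
    have d': "d \<in> simplices D (Cod Delta u)" using d u by simp
    \<comment> \<open>Here \<open>x\<close> is the label of \<open>j ?m d\<close>. The action of
      \<open>u\<close> passes from \<open>E\<close> to \<open>D\<close> through \<open>j\<close> and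
      on to \<open>U_tilde\<close> through \<open>g\<close>, where it acts on points by the
      restriction map of \<open>h\<close>.\<close>
    have "res (k n (i n a)) f u x = \<theta> (Dom Delta u) (act E u e)"
      using k_res[OF smap_mem[OF P'(4) a] f u e(1)] e ia by simp
    also have "act E u e = j (Dom Delta u) (act D u d)"
      using smap_act[OF P'(1) u(1) d'] d u by simp
    also have "\<theta> (Dom Delta u) (j (Dom Delta u) (act D u d)) = pt (Dom Delta u) (snd (g (Dom Delta u) (act D u d)))"
      by (rule \<theta>j[OF act_mem[OF ss(1) u(1) d']])
    also have "snd (g (Dom Delta u) (act D u d)) = act (V_tilde S) u (snd (g ?m d))"
      using smap_act[OF Q'(1) u(1) d'] act_U_tilde[OF u(1), of "h ?m (q ?m d)" "snd (g ?m d)"] gU(3)[OF d(1)] u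
        smap_mem[OF Q'(1) d(1)] by simp
    also have "pt (Dom Delta u) (act (V_tilde S) u (snd (g ?m d))) =
        res (h ?m ?a) (Idn Delta ?m) u (pt ?m (snd (g ?m d)))"
      using pt_act[OF u(1), of "snd (g ?m d)"] gU(1,2)[OF d(1)] d(2) u(2) by simp
    also have "pt ?m (snd (g ?m d)) = x" using \<theta>j[OF d(1)] e d by simp
    also have "res (h ?m ?a) (Idn Delta ?m) u x = res (h n a) f u x"
      using act_V[OF f(1) hV[OF a'], of "Idn Delta ?m" u] h_act[OF f(1) a'] f u
      by (simp add: Delta_Idn Delta_id)
    finally show "res (k n (i n a)) f u x = res (h n a) f u x" .
  qed
  let ?l = "\<lambda>n. \<lambda>e\<in>simplices E n. (k n (p n e), l n e)"
  have "smap_comp A k i = h"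
    by (rule smap_eqI[OF smap_comp_smap[OF P'(4) PU'(4)] Q'(4)]) (simp add: ki)
  moreover have "smap_comp D ?l j = g"
  proof (rule smap_eqI[OF smap_comp_smap[OF P'(1) PU'(1)] Q'(1)])
    fix n d assume d: "d \<in> simplices D n"
    note jd = smap_mem[OF P'(1) d]
    have kp: "k n (p n (j n d)) = h n (q n d)"
      using P'(5)[OF d] ki[OF smap_mem[OF P'(2) d]] by simp
    \<comment> \<open>Both lie over \<open>h n (q n d)\<close> and have the same point, which
      determines a simplex of \<open>V_tilde\<close>.\<close>
    have "l n (j n d) = snd (g n d)"
      by (rule V_tilde_eqI[OF smap_mem[OF K'(1) jd] gU(1)[OF d]])
        (use K'(5)[OF jd] kp gU(2)[OF d] l_pt[OF jd] \<theta>j[OF d] in simp_all)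
    then show "smap_comp D ?l j n d = g n d" using gU(3)[OF d] kp d jd by simp
  qed
  ultimately show thesis by (rule that[OF PU])
qed

theorem corollary5p1p5:
  fixes \<kappa> :: "'k rel" and S :: "'u set set"
  assumes "Card_order \<kappa>" and "regularCard \<kappa>" and "|Ar Delta| <o \<kappa>"
    and "small_sets \<kappa> S"
  shows "small_kan_fibration \<kappa> (U_tilde S) (U_base S) (U_proj S) \<and>
    (\<forall>(A :: 'a sset) (B :: 'b sset) (D :: 'd sset) (E :: 'e sset) i q p j g h.
       is_mono A B i \<and> small_kan_fibration \<kappa> D A q \<and> small_kan_fibration \<kappa> E B p \<and>
       is_pullback D E A B j q p i \<and> is_pullback D (U_tilde S) A (U_base S) g q (U_proj S) h \<longrightarrow>
       (\<exists>k l. is_pullback E (U_tilde S) B (U_base S) l p (U_proj S) k \<and>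
          smap_comp A k i = h \<and> smap_comp D l j = g))"
proof (intro conjI allI impI)
  show "small_kan_fibration \<kappa> (U_tilde S) (U_base S) (U_proj S)"
    using small_map_U_proj[OF assms(4)] kan_fibration_U_proj by (simp add: small_kan_fibration_def)
  fix A :: "'a sset" and B :: "'b sset" and D :: "'d sset" and E :: "'e sset" and i q p j g h
  assume "is_mono A B i \<and> small_kan_fibration \<kappa> D A q \<and> small_kan_fibration \<kappa> E B p \<and>
    is_pullback D E A B j q p i \<and> is_pullback D (U_tilde S) A (U_base S) g q (U_proj S) h"
  then obtain l k where "is_pullback E (U_tilde S) B (U_base S) l p (U_proj S) k"
    "smap_comp A k i = h" "smap_comp D l j = g"
    using realignment[OF assms(1,4), of A B i E p D j q g h] by blast
  then show "\<exists>k l. is_pullback E (U_tilde S) B (U_base S) l p (U_proj S) k \<and>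
      smap_comp A k i = h \<and> smap_comp D l j = g"
    by blast
qed

end
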